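(* For every odd prime $p>2$, \[ \sum_{k=0}^{\frac{p-1}{2}}\frac{(-1)^k(172k^2+75k+9)}{2^{12k}}\binom{2k}{k}^3\binom{3k}{k}\binom{4k}{2k} \equiv 9p^2+6p^3q_p(2)-9p^4q_p(2)^2 \pmod{p^5}. \]
   Context: For an odd prime $p$, the Fermat quotient is $q_p(2)=\frac{2^{p-1}-1}{p}$. Congruences between rational numbers whose denominators are coprime to $p$ are understood in the ring of $p$-integral rationals. *)

theory Defs
  imports Complex_Main "HOL-Computational_Algebra.Primes"
begin

definition p_integral :: "nat \<Rightarrow> rat \<Rightarrow> bool" where
  "p_integral p r \<longleftrightarrow> coprime (snd (quotient_of r)) (int p)"

definition rat_cong_pow :: "rat \<Rightarrow> rat \<Rightarrow> nat \<Rightarrow> nat \<Rightarrow> bool" where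
  "rat_cong_pow a b p n \<longleftrightarrow> p_integral p ((a - b) / of_nat (p ^ n))"

definition fermat_quot2 :: "nat \<Rightarrow> rat" where
  "fermat_quot2 p = (2 ^ (p - 1) - 1) / of_nat p"

end

theory Submission
  imports Defs "HOL-Computational_Algebra.Polynomial"
begin

text \<open>
  With \<open>a = 1/2 + x\<close> for a formal variable \<open>x\<close>, the summand of the theorem is \<open>-96\<close> times the
  value at \<open>x = 0\<close> of a polynomial \<open>T n\<close>, which is the boundary term \<open>g n 0\<close> of a WZ pair
  \<open>(f, g)\<close> obtained from Dougall's bilateral \<open>5H5\<close> sum. Writing \<open>p = 2 m + 1\<close> and \<open>w = p/2 - x\<close>,
  \<open>w' = p/2 + x\<close>, telescoping turns \<open>S = T 0 + ... + T m\<close> into the sum of \<open>f (m+1) j\<close> for \<open>1 \<le> j \<le> m+1\<close>.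
  There \<open>p\<^sup>2 S = w^4 w' U + w\<^sup>2 (w + p) w' V\<close>, where \<open>U\<close> has \<open>p\<close>-integral coefficients and the last term
  gives \<open>V\<close>, a product of linear factors with \<open>V \<equiv> - a\<close> modulo \<open>(p, x)^3\<close>. Hence \<open>S 0\<close> modulo \<open>p^5\<close>
  only depends on \<open>U 0\<close> modulo \<open>p\<^sup>2\<close>.

  This last unknown is forced by integrality: all \<open>T n\<close> with \<open>n < m\<close> have \<open>p\<close>-integral coefficients, and
  \<open>p\<^sup>2 T m\<close> is again an explicit product, so that the coefficients of \<open>x^5\<close> and \<open>x^6\<close> in
  \<open>p\<^sup>2 (S - T m) \<equiv> 0\<close> yield \<open>U 0 \<equiv> h + p h\<^sup>2 / 2\<close> modulo \<open>p\<^sup>2\<close> for the harmonic number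
  \<open>h = 1 + 1/2 + ... + 1/m\<close>, which is \<open>- 2 q + p q\<^sup>2\<close> modulo \<open>p\<^sup>2\<close> for the Fermat quotient \<open>q\<close>.
\<close>

section \<open>A WZ pair with a free parameter\<close>

text \<open>The certificate of the WZ pair was found by interpolating \<open>wz_g\<close> at small arguments.\<close>

definition wz_cert0 :: "'a::comm_ring_1 \<Rightarrow> 'a \<Rightarrow> 'a" where
  "wz_cert0 n a = (-6*a^2 + 15*a^3 - 12*a^4 + 3*a^5) + (6*a - 63*a^2 + 105*a^3 - 57*a^4 + 9*a^5)*n
     + (12 + 17*a - 207*a^2 + 228*a^3 - 63*a^4)*n^2 + (98 - 54*a - 243*a^2 + 147*a^3)*n^3
     + (288 - 201*a - 81*a^2)*n^4 + (366 - 152*a)*n^5 + 172*n^6"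

definition wz_cert :: "'a::comm_ring_1 \<Rightarrow> 'a \<Rightarrow> 'a \<Rightarrow> 'a" where
  "wz_cert n j a = n * wz_cert0 n a
     + j * ((2*a^2 - 5*a^3 + 4*a^4 - a^5) + (4*a + 9*a^2 - 32*a^3 + 25*a^4 - 6*a^5)*n
        + (2 + 27*a + 6*a^2 - 52*a^3 + 24*a^4)*n^2 + (5 + 88*a - 36*a^2 - 16*a^3)*n^3
        + (-2 + 117*a - 36*a^2)*n^4 + (-21 + 54*a)*n^5 - 20*n^6)
     + j^2 * ((-2*a + 4*a^2 - a^3 - 2*a^4 + a^5) + (-2 - 16*a + 39*a^2 - 26*a^3 + 5*a^4)*n
        + (-14 - 45*a + 84*a^2 - 32*a^3)*n^2 + (-49 - 42*a + 48*a^2)*n^3 + (-78 - 9*a)*n^4 - 45*n^5)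
     + 2 * j^3 * (n + a) * (n + 1 - a)^3 - j^4 * (n + 1 - a)^3"

text \<open>What is left of the WZ equation once the factor \<open>c\<close> common to its four
  terms in \<open>wz_step\<close> has been cancelled.\<close>

lemma wz_cert_step:
  fixes n j a :: "rat"
  shows "-((1 - a + n)^3 * (2*n+j-1-a)*(2*n+j-a)*(2*n+j+1-a)*(a+n)*(3*n-j)*(3*n-j+1)*(3*n-j+2)*(a+n+1-2*j))
     - (2*n+j-1-a)*(a+n-2*j)*(n-j+1)^3*(2*n)^3*(2*n+1)^3
    = (j-a)^3*(3*n-j)*wz_cert n (j-1) a - (2*n+j-1-a)*(n-j+1)^3*wz_cert n j a"
  unfolding wz_cert_def wz_cert0_def by algebra

text \<open>On the diagonal the certificate splits into linear factors. They are the ones by which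
  the rising factorials and the factorial of \<open>wz_f\<close> grow from \<open>n\<close> to the
  new diagonal term at \<open>n + 1\<close>, which is what \<open>wz_diag\<close> needs.\<close>

lemma wz_cert_diag:
  fixes n a :: "rat"
  shows "wz_cert n n a = -((a-n-1)*(3*n-a)*(3*n+1-a)*(3*n+2-a)*(a+n)*(2*n)*(2*n+1))"
  unfolding wz_cert_def wz_cert0_def by algebra

text \<open>Terms are split into a rational coefficient and a core over any commutative ring, so
  that \<open>a\<close> can be a rational number in the WZ argument and the polynomial
  \<open>av\<close> afterwards.\<close>

definition wz_f_core :: "nat \<Rightarrow> nat \<Rightarrow> 'a::comm_ring_1 \<Rightarrow> 'a" where
  "wz_f_core n j a = (a + of_nat n - 2 * of_nat j) * pochhammer (1 - a + of_nat j) (n - j) ^ 3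
     * pochhammer (- a) (2 * n + j) * pochhammer a n"

definition wz_f_coeff :: "nat \<Rightarrow> nat \<Rightarrow> rat" where
  "wz_f_coeff n j = (-1) ^ n * fact (3 * n - j - 1) / (fact (n - j) ^ 3 * fact (2 * n - 1) ^ 3)"

definition wz_g :: "nat \<Rightarrow> nat \<Rightarrow> rat \<Rightarrow> rat" where
  "wz_g n j a = (-1) ^ n * fact (3 * n - j - 1) / (fact (n - j) ^ 3 * fact (2 * n + 1) ^ 3)
     * (pochhammer (1 - a + of_nat j) (n - j) ^ 3 * pochhammer (- a) (2 * n + j) * pochhammer a n
        * wz_cert (of_nat n) (of_nat j) a)"

text \<open>The factor \<open>n\<close> of \<open>wz_cert n 0 a\<close> is moved into the
  coefficient, where \<open>n * fact (3 * n - 1)\<close> becomes \<open>fact (3 * n) / 3\<close>.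
  This gives the right term for \<open>n = 0\<close> too, where \<open>wz_g 0 0 a\<close>
  vanishes.\<close>

definition term_core :: "nat \<Rightarrow> 'a::comm_ring_1 \<Rightarrow> 'a" where
  "term_core n a = wz_cert0 (of_nat n) a * pochhammer (- a) (2 * n) * pochhammer (1 - a) n ^ 3 * pochhammer a n"

definition term_coeff :: "nat \<Rightarrow> rat" where
  "term_coeff n = (-1) ^ n * fact (3 * n) / (3 * fact n ^ 3 * fact (2 * n + 1) ^ 3)"

text \<open>All rising factorials and factorials are reduced to their shortest versions, so that
  every term becomes a polynomial times one common factor; then \<open>wz_cert_step\<close>
  applies.\<close>

lemma wz_step:
  fixes a :: rat
  assumes "1 \<le> j" "j \<le> n"
  shows "wz_f_coeff (Suc n) j * wz_f_core (Suc n) j a - wz_f_coeff n j * wz_f_core n j a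
    = wz_g n (j - 1) a - wz_g n j a"
proof -
  obtain i where j: "j = Suc i" using assms by (cases j) auto
  obtain r where n: "n = Suc i + r" using assms j by (metis le_iff_add)
  define J where "J = (of_nat j :: rat)"
  define A where "A = pochhammer (1 - a + J) r"
  define B where "B = pochhammer (- a) (2 * n + i)"
  define C where "C = pochhammer a n"
  define F where "F = (fact (3 * n - j - 1) :: rat)"
  define N where "N = (of_nat n :: rat)"
  have nj: "n - j = r" "Suc n - j = Suc r" "n - i = Suc r" "j - 1 = i"
    using j n by auto
  have NJ: "of_nat r = N - J" "of_nat i = J - 1" by (auto simp: N_def J_def j n)
  have p1: "pochhammer (1 - a + J) (Suc r) = A * (1 - a + N)"
    by (simp add: pochhammer_Suc A_def J_def[symmetric] NJ)
  have p2: "pochhammer (1 - a + (J - 1)) (Suc r) = (J - a) * A"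
    by (simp add: pochhammer_rec A_def NJ add.commute add_diff_eq flip: J_def)
  have p3: "pochhammer (- a) (2 * n + j) = B * (2 * N + J - 1 - a)"
    by (simp add: j pochhammer_Suc B_def NJ flip: N_def)
  have p4: "pochhammer (- a) (2 * Suc n + j) = B * (2*N+J-1-a) * (2*N+J-a) * (2*N+J+1-a)"
  proof -
    have "2 * Suc n + j = Suc (Suc (2 * n + j))" by simp
    then show ?thesis by (simp only: pochhammer_Suc p3) (simp flip: N_def J_def)
  qed
  have p5: "pochhammer a (Suc n) = C * (a + N)"
    by (simp add: pochhammer_Suc C_def N_def)
  have e: "3 * Suc n - j - 1 = Suc (Suc (Suc (3 * n - j - 1)))" "3 * n - i - 1 = Suc (3 * n - j - 1)"
    using j n by auto
  have of: "of_nat (3 * n - j - 1) = 3 * N - J - 1"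
  proof -
    have "3 * n - j - 1 + j + 1 = 3 * n" using j n by simp
    then have "of_nat (3 * n - j - 1 + j + 1) = (of_nat (3 * n) :: rat)" by (rule arg_cong)
    then have "of_nat (3 * n - j - 1) + J + 1 = 3 * N"
      unfolding of_nat_add of_nat_mult of_nat_numeral of_nat_1 N_def J_def .
    then show ?thesis by (simp add: algebra_simps)
  qed
  have f1: "fact (3 * Suc n - j - 1) = F * (3*N-J)*(3*N-J+1)*(3*N-J+2)"
    unfolding e fact_Suc of_nat_Suc of F_def[symmetric] by (simp add: algebra_simps)
  have f2: "fact (3 * n - i - 1) = F * (3*N-J)"
    unfolding e fact_Suc of_nat_Suc of F_def[symmetric] by (simp add: algebra_simps)
  have f3: "fact (Suc r) = fact r * (N - J + 1)" by (simp add: NJ)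
  have f4: "fact (2 * n + 1) = fact (2 * n - 1) * (2 * N) * (2 * N + 1)"
  proof -
    have "2 * n + 1 = Suc (Suc (2 * n - 1))" using n by simp
    moreover have "of_nat (2 * n - 1) = 2 * N - (1 :: rat)" using n by (simp add: N_def)
    ultimately show ?thesis by (simp only: fact_Suc of_nat_Suc) (simp add: algebra_simps)
  qed
  have nz: "N - J + 1 \<noteq> 0" "N \<noteq> 0" "2 * N + 1 \<noteq> 0"
    using n by (auto simp: N_def J_def j add_nonneg_eq_0_iff)
  define G where "G = (fact (2 * n + 1) :: rat)"
  have nz': "fact (2 * n - 1) = G / ((2 * N) * (2 * N + 1))" using nz f4 by (simp add: G_def)
  have G0: "G \<noteq> 0" by (simp add: G_def)
  \<comment> \<open>The shortest numerators over the longest denominators,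
    \<open>fact (n + 1 - j)^3 * fact (2 * n + 1)^3\<close>.\<close>
  define c where "c = (-1) ^ n * A ^ 3 * B * C * F / ((N - J + 1) ^ 3 * fact r ^ 3 * G ^ 3)"
  have 1: "wz_f_coeff (Suc n) j * wz_f_core (Suc n) j a =
     c * -((1 - a + N)^3 * (2*N+J-1-a)*(2*N+J-a)*(2*N+J+1-a)*(a+N)*(3*N-J)*(3*N-J+1)*(3*N-J+2)*(a+N+1-2*J))"
  proof -
    define s where "s = (-1 :: rat) ^ n"
    have s: "(-1) ^ Suc n = - s" by (simp add: s_def)
    have e': "2 * Suc n - 1 = 2 * n + 1" by simp
    show ?thesis
      unfolding e'  wz_f_coeff_def wz_f_core_def nj p4 p5 f1 f3 J_def[symmetric] p1 c_def s s_def[symmetric]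
        of_nat_Suc N_def[symmetric] power_mult_distrib divide_inverse inverse_mult_distrib
        G_def[symmetric]
      by algebra
  qed
  have 2: "wz_f_coeff n j * wz_f_core n j a =
     c * ((2*N+J-1-a)*(a+N-2*J)*(N-J+1)^3*(2*N)^3*(2*N+1)^3)"
    unfolding wz_f_coeff_def wz_f_core_def nj p3 nz' F_def[symmetric] A_def[symmetric] C_def[symmetric]
      J_def[symmetric] N_def[symmetric] c_def using nz G0
    by (simp add: power_mult_distrib power_divide)
  have 3: "wz_g n (j - 1) a = c * ((J-a)^3*(3*N-J)*wz_cert N (J-1) a)"
    unfolding wz_g_def nj p2 f2 f3 B_def[symmetric] NJ C_def[symmetric] N_def[symmetric] c_def G_def[symmetric]
    using nz G0 by (simp add: power_mult_distrib mult_ac)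
  have 4: "wz_g n j a = c * ((2*N+J-1-a)*(N-J+1)^3*wz_cert N J a)"
    unfolding wz_g_def nj p3 F_def[symmetric] A_def[symmetric] C_def[symmetric]
      J_def[symmetric] N_def[symmetric] c_def G_def[symmetric] using nz G0
    by (simp add: power_mult_distrib)
  show ?thesis
    unfolding 1 2 3 4 right_diff_distrib[symmetric] wz_cert_step ..
qed

text \<open>The sum over \<open>j\<close> gains the term \<open>j = n + 1\<close> when
  \<open>n\<close> grows; this term cancels the far boundary value of the telescoping sum.\<close>

lemma wz_diag:
  fixes a :: rat
  assumes "n \<ge> 1"
  shows "wz_f_coeff (Suc n) (Suc n) * wz_f_core (Suc n) (Suc n) a = wz_g n n a"
proof -
  define N where "N = (of_nat n :: rat)"
  define F where "F = (fact (2 * n - 1) :: rat)"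
  have p: "pochhammer (- a) (2 * Suc n + Suc n) = pochhammer (- a) (2 * n + n) * (3*N-a)*(3*N+1-a)*(3*N+2-a)"
  proof -
    have "2 * Suc n + Suc n = Suc (Suc (Suc (2 * n + n)))" by simp
    then show ?thesis by (simp only: pochhammer_Suc) (simp add: N_def algebra_simps)
  qed
  have e: "3 * Suc n - Suc n - 1 = Suc (Suc (2 * n - 1))" "2 * Suc n - 1 = 2 * n + 1" "3 * n - n - 1 = 2 * n - 1"
    using assms by auto
  have of: "of_nat (2 * n - 1) = 2 * N - (1 :: rat)" using assms by (simp add: N_def)
  have f: "fact (Suc (Suc (2 * n - 1))) = F * (2 * N) * (2 * N + 1)"
    unfolding fact_Suc of_nat_Suc of F_def[symmetric] by (simp add: algebra_simps)
  define s where "s = (-1 :: rat) ^ n"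
  have s: "(-1) ^ Suc n = - s" by (simp add: s_def)
  show ?thesis
    unfolding wz_f_coeff_def wz_f_core_def wz_g_def p f wz_cert_diag N_def[symmetric] e F_def[symmetric]
      pochhammer_Suc of_nat_Suc diff_self_eq_0 pochhammer_0 fact_0 power_one mult_1 mult_1_right divide_inverse
      s s_def[symmetric]
    by algebra
qed

lemma wz_g_0:
  fixes a :: rat
  assumes "n \<ge> 1"
  shows "wz_g n 0 a = term_coeff n * term_core n a"
proof -
  have "3 * n = Suc (3 * n - 1)" using assms by simp
  then have "(fact (3 * n) :: rat) = of_nat (3 * n) * fact (3 * n - 1)"
    by (metis fact_Suc)
  then show ?thesis using assms
    by (simp add: wz_g_def term_coeff_def term_core_def wz_cert_def field_simps)
qed

text \<open>Summing the WZ equation over \<open>1 \<le> j \<le> n\<close> gives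
  \<open>g n 0 - g n n\<close>, and the new diagonal term is \<open>g n n\<close>. So passing from
  \<open>n\<close> to \<open>n + 1\<close> on the right adds exactly \<open>g n 0\<close>.\<close>

lemma wz_sum:
  fixes a :: rat
  shows "(\<Sum>n\<le>m. term_coeff n * term_core n a) =
    (\<Sum>j=1..Suc m. wz_f_coeff (Suc m) j * wz_f_core (Suc m) j a)"
proof (induction m)
  case 0
  show ?case
    by (simp add: term_coeff_def term_core_def wz_f_coeff_def wz_f_core_def wz_cert0_def pochhammer_Suc
        numeral_eq_Suc field_simps)
next
  case (Suc m)
  let ?f = "\<lambda>n j. wz_f_coeff n j * wz_f_core n j a"
  define n where "n = Suc m"
  have "(\<Sum>j=1..Suc n. ?f (Suc n) j) = (\<Sum>j=1..n. ?f (Suc n) j) + ?f (Suc n) (Suc n)"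
    by simp
  also have "(\<Sum>j=1..n. ?f (Suc n) j) = (\<Sum>j=1..n. ?f n j + (wz_g n (j - 1) a - wz_g n j a))"
    by (rule sum.cong) (use wz_step[where a = a] in \<open>auto simp: algebra_simps\<close>)
  also have "\<dots> = (\<Sum>j=1..n. ?f n j) + (\<Sum>j=1..n. wz_g n (j - 1) a - wz_g n j a)"
    by (rule sum.distrib)
  also have "(\<Sum>j=1..n. wz_g n (j - 1) a - wz_g n j a) = wz_g n 0 a - wz_g n n a"
    using sum_telescope''[of 0 n "\<lambda>j. - wz_g n j a"] by simp
  finally show ?case
    using Suc.IH wz_diag[of n a] wz_g_0[of n a] by (simp add: n_def)
qed

section \<open>Passage to polynomials in x, with a = 1/2 + x\<close>

lemma poly_pochhammer: "poly (pochhammer f n) x = pochhammer (poly f x) n"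
  by (simp add: pochhammer_prod poly_prod)

lemma poly_wz_cert0: "poly (wz_cert0 f g) x = wz_cert0 (poly f x) (poly g x)"
  by (simp add: wz_cert0_def)

lemma poly_term_core: "poly (term_core n f) x = term_core n (poly f x)"
  by (simp add: term_core_def poly_pochhammer poly_wz_cert0)

lemma poly_wz_f_core: "poly (wz_f_core n j f) x = wz_f_core n j (poly f x)"
  by (simp add: wz_f_core_def poly_pochhammer)

text \<open>Isolates a single factor \<open>u\<close> in the middle of a rising factorial; it is
  applied to the factor \<open>w\<close>, which lies in the ideal (p, x).\<close>

lemma pochhammer_split:
  assumes "z + of_nat n = (u :: 'a :: comm_ring_1)" "N = n + Suc k"
  shows "pochhammer z N = pochhammer z n * (u * pochhammer (u + 1) k)"
  unfolding assms(2) pochhammer_product' assms(1) pochhammer_rec ..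

abbreviation (input) av :: "rat poly" where "av \<equiv> [:1/2, 1:]"

definition T_poly :: "nat \<Rightarrow> rat poly" where
  "T_poly n = smult (term_coeff n) (term_core n av)"

definition F_poly :: "nat \<Rightarrow> nat \<Rightarrow> rat poly" where
  "F_poly n j = smult (wz_f_coeff n j) (wz_f_core n j av)"

text \<open>Polynomials over the rationals are equal if all their values are, so
  \<open>wz_sum\<close> lifts.\<close>

lemma T_poly_sum: "(\<Sum>n\<le>m. T_poly n) = (\<Sum>j=1..Suc m. F_poly (Suc m) j)"
  by (intro poly_eq_poly_eq_iff[THEN iffD1] ext)
     (simp only: poly_sum T_poly_def F_poly_def poly_smult poly_term_core poly_wz_f_core wz_sum)

lemma T_poly_at_0:
  "poly (T_poly n) 0 = - ((-1) ^ n * (172 * of_nat n ^ 2 + 75 * of_nat n + 9) / 2 ^ (12 * n)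
        * of_nat (2 * n choose n) ^ 3 * of_nat (3 * n choose n) * of_nat (4 * n choose (2 * n))) / 96"
proof -
  define N where "N = (of_nat n :: rat)"
  \<comment> \<open>At a = 1/2 the certificate factors: the quadratic of the theorem appears,
    \<open>(2*N + 1)^3\<close> cancels against \<open>fact (2*n+1)^3\<close>, and
    \<open>4*N - 1\<close> is absorbed by \<open>neg\<close>.\<close>
  have c0: "wz_cert0 N (1/2) = (172*N^2 + 75*N + 9) * (4*N - 1) * (2*N + 1)^3 / 32"
    unfolding wz_cert0_def by (simp add: field_simps power2_eq_square power3_eq_cube power4_eq_xxxx numeral_eq_Suc)
  have half: "pochhammer (1/2) k = (fact (2*k) :: rat) / (4^k * fact k)" for k
  proof -
    have "(2::rat)^(2*k) = 4^k" by (simp add: power_mult)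
    then show ?thesis using fact_double[of k, where ?'a = rat] by (simp add: field_simps)
  qed
  have neg: "(4*N - 1) * pochhammer (-(1/2)) (2*n) = - pochhammer (1/2 :: rat) (2*n)"
  proof -
    have "pochhammer (-(1/2) :: rat) (Suc (2*n)) = -(1/2) * pochhammer (1/2) (2*n)"
      by (simp add: pochhammer_rec)
    moreover have "pochhammer (-(1/2) :: rat) (Suc (2*n)) = pochhammer (-(1/2)) (2*n) * ((4*N - 1) / 2)"
      by (simp add: pochhammer_Suc N_def field_simps)
    ultimately show ?thesis by (simp add: field_simps)
  qed
  have b1: "of_nat (2 * n choose n) = (fact (2*n) :: rat) / (fact n)^2"
    by (subst binomial_fact) (auto simp: power2_eq_square)
  have b2: "of_nat (3 * n choose n) = (fact (3*n) :: rat) / (fact n * fact (2*n))"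
    by (subst binomial_fact) auto
  have b3: "of_nat (4 * n choose (2*n)) = (fact (4*n) :: rat) / (fact (2*n))^2"
    by (subst binomial_fact) (auto simp: power2_eq_square)
  have f: "fact (2*n+1) = (2*N+1) * (fact (2*n) :: rat)" by (simp add: N_def algebra_simps)
  have N0: "2*N+1 \<noteq> 0" by (auto simp: N_def add_nonneg_eq_0_iff)
  \<comment> \<open>The denominators of \<open>half\<close>: one rising factorial of length
    \<open>2*n\<close> and four of length \<open>n\<close>.\<close>
  have t4096: "(2::rat)^(12*n) = 4^(2*n) * (4^n)^4"
  proof -
    have "((4::rat)^n)^4 = 256^n"
      unfolding power_mult[symmetric] mult.commute[of n] by (simp add: power_mult)
    then show ?thesis by (simp add: power_mult flip: power_mult_distrib)
  qed
  have "poly (T_poly n) 0 = term_coeff n * ((172*N^2 + 75*N + 9) * (2*N + 1)^3 / 32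
      * ((4*N - 1) * pochhammer (-(1/2)) (2*n)) * pochhammer (1/2) n ^ 4)"
    unfolding T_poly_def poly_smult poly_term_core
    by (simp add: term_core_def c0 power4_eq_xxxx power3_eq_cube flip: N_def)
  also have "\<dots> = - ((-1) ^ n * (172*N^2 + 75*N + 9) / (4^(2*n) * (4^n)^4) * fact (3*n) * fact (4*n) / fact n ^ 7) / 96"
    unfolding neg half term_coeff_def f using N0
    by (simp add: power_mult_distrib power_divide divide_simps) (simp add: power_numeral_reduce mult_ac)
  also have "\<dots> = - ((-1) ^ n * (172*N^2 + 75*N + 9) / 2^(12*n) * of_nat (2 * n choose n) ^ 3
     * of_nat (3 * n choose n) * of_nat (4 * n choose (2*n))) / 96"
    unfolding b1 b2 b3 t4096
    by (simp add: power_mult_distrib power_divide divide_simps) (simp add: power_numeral_reduce mult_ac)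
  finally show ?thesis by (simp add: N_def)
qed

section \<open>Rational polynomials modulo powers of the ideal (p, x)\<close>

text \<open>Replaces the reduced fraction by any fraction with denominator prime to p, which makes
  closure under sums and products immediate.\<close>

lemma p_integral_iff:
  assumes "prime p"
  shows "p_integral p r \<longleftrightarrow> (\<exists>a b. \<not> int p dvd b \<and> r = of_int a / of_int b)"
proof
  assume *: "p_integral p r"
  obtain a b where ab: "quotient_of r = (a, b)" by (cases "quotient_of r")
  have "\<not> int p dvd b"
  proof
    assume "int p dvd b"
    then have "is_unit (int p)"
      using * ab by (auto simp: p_integral_def intro: coprime_common_divisor)
    then show False using assms prime_gt_1_nat[OF assms] by simp
  qed
  then show "\<exists>a b. \<not> int p dvd b \<and> r = of_int a / of_int b"
    using quotient_of_div[OF ab] by blast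
next
  assume "\<exists>a b. \<not> int p dvd b \<and> r = of_int a / of_int b"
  then obtain a b where b: "\<not> int p dvd b" and r: "r = of_int a / of_int b" by blast
  obtain c d where cd: "quotient_of r = (c, d)" by (cases "quotient_of r")
  have "b \<noteq> 0" using b by auto
  have "d > 0" using cd by (metis quotient_of_denom_pos)
  have "of_int c / of_int d = (of_int a / of_int b :: rat)"
    using quotient_of_div[OF cd] r by simp
  then have "rat_of_int (c * b) = rat_of_int (a * d)"
    using \<open>b \<noteq> 0\<close> \<open>d > 0\<close> by (simp add: field_simps)
  then have "c * b = a * d" by (simp only: of_int_eq_iff)
  then have "d dvd c * b" by simp
  moreover have "coprime d c"
    using quotient_of_coprime[OF cd] by (simp add: coprime_commute)
  ultimately have "d dvd b" by (simp add: coprime_dvd_mult_right_iff)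
  then have "\<not> int p dvd d" using b dvd_trans by blast
  then have "coprime (int p) d"
    using assms by (simp add: prime_imp_coprime)
  then show "p_integral p r" by (simp add: p_integral_def cd coprime_commute)
qed

lemma prod_pair_reflect:
  fixes g :: "nat \<Rightarrow> 'a::comm_monoid_mult"
  shows "(\<Prod>l=1..2*m. g l) = (\<Prod>i=1..m. g i * g (2*m+1-i))"
proof -
  have "{1..2*m} = {1..m} \<union> {m+1..2*m}" by auto
  then have "(\<Prod>l=1..2*m. g l) = (\<Prod>l=1..m. g l) * (\<Prod>l=m+1..2*m. g l)"
    by (simp add: prod.union_disjoint)
  also have "(\<Prod>l=m+1..2*m. g l) = (\<Prod>i=1..m. g (2*m+1-i))"
    by (rule prod.reindex_bij_witness[of _ "\<lambda>i. 2*m+1-i" "\<lambda>i. 2*m+1-i"]) auto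
  finally show ?thesis by (simp add: prod.distrib)
qed

text \<open>As 2m + 1 is odd, each pair {l, 2m + 1 - l} has exactly one even member, so these are
  the pairs of \<open>prod_pair_reflect\<close> indexed differently.\<close>

lemma prod_pair_even:
  fixes g :: "nat \<Rightarrow> 'a::comm_monoid_mult"
  shows "(\<Prod>l=1..2*m. g l) = (\<Prod>i=1..m. g (2*i) * g (2*m+1-2*i))"
proof -
  have "(\<Prod>l=1..2*m. g l) = (\<Prod>i=1..m. g (2*i)) * (\<Prod>i=1..m. g (2*i-1))"
    by (induction m) (auto simp: mult_ac)
  also have "(\<Prod>i=1..m. g (2*i-1)) = (\<Prod>i=1..m. g (2*m+1-2*i))"
    by (rule prod.reindex_bij_witness[of _ "\<lambda>i. m+1-i" "\<lambda>i. m+1-i"])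
       (auto intro!: arg_cong[where f = g])
  finally show ?thesis by (simp add: prod.distrib)
qed

lemma fact_poly: "(fact k :: rat poly) = [:fact k:]"
  by (metis of_nat_fact of_nat_poly)

lemma coeff_list10:
  "coeff [:a0, a1, a2, a3, a4, a5, a6, a7, a8, a9:] 5 = a5"
  "coeff [:a0, a1, a2, a3, a4, a5, a6, a7, a8, a9:] 6 = a6"
  by (simp_all add: coeff_pCons eval_nat_numeral)

lemma smult_sum_right: "smult c (sum f A) = (\<Sum>i\<in>A. smult c (f i))"
  by (induction A rule: infinite_finite_induct) (simp_all add: smult_add_right)

text \<open>The prime 3 is kept out because 3 has to be invertible and because rising factorials of
  length \<open>m - 2\<close> occur.\<close>

locale prime_gt_3 =
  fixes p m :: nat
  assumes prime_p: "prime p" and p_eq: "p = 2 * m + 1" and m_ge_2: "m \<ge> 2"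
begin

lemma p_gt_3: "p > 3"
  using p_eq m_ge_2 by simp

section \<open>Closure properties of the p-integral rationals\<close>

lemma integral_of_int [simp, intro]: "p_integral p (of_int k)"
  unfolding p_integral_iff[OF prime_p]
  by (intro exI[of _ k] exI[of _ 1]) (use p_gt_3 in auto)

lemma integral_of_nat [simp, intro]: "p_integral p (of_nat k)"
  using integral_of_int[of "int k"] by simp

lemma integral_numeral [simp, intro]: "p_integral p (numeral k)"
  using integral_of_nat[of "numeral k"] by simp

lemma integral_0 [simp, intro]: "p_integral p 0" and integral_1 [simp, intro]: "p_integral p 1"
  using integral_of_nat[of 0] integral_of_nat[of 1] by simp_all

lemma integral_add [intro]: "p_integral p r \<Longrightarrow> p_integral p s \<Longrightarrow> p_integral p (r + s)"
proof -
  assume "p_integral p r" "p_integral p s"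
  then obtain a b c d where *: "\<not> int p dvd b" "r = of_int a / of_int b" "\<not> int p dvd d" "s = of_int c / of_int d"
    unfolding p_integral_iff[OF prime_p] by blast
  then have "b \<noteq> 0" "d \<noteq> 0" by auto
  then have "r + s = of_int (a * d + c * b) / of_int (b * d)" using * by (simp add: field_simps)
  moreover have "\<not> int p dvd b * d" using * prime_p by (simp add: prime_dvd_mult_iff)
  ultimately show ?thesis unfolding p_integral_iff[OF prime_p] by blast
qed

lemma integral_mult [intro]: "p_integral p r \<Longrightarrow> p_integral p s \<Longrightarrow> p_integral p (r * s)"
proof -
  assume "p_integral p r" "p_integral p s"
  then obtain a b c d where *: "\<not> int p dvd b" "r = of_int a / of_int b" "\<not> int p dvd d" "s = of_int c / of_int d"
    unfolding p_integral_iff[OF prime_p] by blast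
  then have "b \<noteq> 0" "d \<noteq> 0" by auto
  then have "r * s = of_int (a * c) / of_int (b * d)" using * by (simp add: field_simps)
  moreover have "\<not> int p dvd b * d" using * prime_p by (simp add: prime_dvd_mult_iff)
  ultimately show ?thesis unfolding p_integral_iff[OF prime_p] by blast
qed

lemma integral_minus [intro]: "p_integral p r \<Longrightarrow> p_integral p (- r)"
  using integral_mult[OF integral_of_int[of "-1"], of r] by simp

lemma integral_diff [intro]: "p_integral p r \<Longrightarrow> p_integral p s \<Longrightarrow> p_integral p (r - s)"
  using integral_add[of r "- s"] by (auto intro: integral_minus)

lemma integral_power [intro]: "p_integral p r \<Longrightarrow> p_integral p (r ^ k)"
  by (induction k) auto

lemma integral_sum [intro]: "(\<And>i. i \<in> A \<Longrightarrow> p_integral p (f i)) \<Longrightarrow> p_integral p (sum f A)"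
  by (induction A rule: infinite_finite_induct) auto

lemma integral_inverse: "\<not> p dvd k \<Longrightarrow> p_integral p (1 / of_nat k)"
  unfolding p_integral_iff[OF prime_p]
  by (intro exI[of _ 1] exI[of _ "int k"]) auto

lemma not_dvd_small: "0 < k \<Longrightarrow> k < p \<Longrightarrow> \<not> p dvd k"
  by (auto dest: dvd_imp_le)

lemma not_dvd_2: "\<not> p dvd 2" and not_dvd_3: "\<not> p dvd 3"
  using not_dvd_small[of 2] not_dvd_small[of 3] p_gt_3 by auto

lemma integral_div:
  assumes "p_integral p r" "\<not> p dvd k"
  shows "p_integral p (r / of_nat k)"
  using integral_mult[OF assms(1) integral_inverse[OF assms(2)]] by simp

lemma integral_div_fact:
  assumes "p_integral p r" "k < p"
  shows "p_integral p (r / fact k)"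
proof -
  have "\<not> p dvd fact k" using assms(2) prime_p by (simp add: prime_dvd_fact_iff)
  from integral_div[OF assms(1) this] show ?thesis by simp
qed

lemma integral_p_times_div:
  assumes "p_integral p (r / of_nat p ^ k)" "l \<le> k"
  shows "p_integral p (r / of_nat p ^ l)"
proof -
  have "r / of_nat p ^ l = r / of_nat p ^ k * of_nat (p ^ (k - l))"
    using assms(2) p_gt_3 by (simp add: field_simps flip: power_add)
  then show ?thesis using assms(1) by (metis integral_mult integral_of_nat)
qed

text \<open>With truncated subtraction in the exponent, this says that the polynomial lies in the
  \<open>k\<close>-th power of the ideal \<open>(p, x)\<close> of the ring of polynomials with \<open>p\<close>-integral coefficients.\<close>

definition Fil :: "nat \<Rightarrow> rat poly set" where
  "Fil k = {g. \<forall>i. p_integral p (coeff g i / of_nat p ^ (k - i))}"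

lemma Fil_add [intro]: "f \<in> Fil k \<Longrightarrow> g \<in> Fil k \<Longrightarrow> f + g \<in> Fil k"
  by (auto simp: Fil_def add_divide_distrib)

lemma Fil_minus [intro]: "f \<in> Fil k \<Longrightarrow> - f \<in> Fil k"
  unfolding Fil_def by simp (metis integral_minus minus_divide_left)

lemma Fil_diff [intro]: "f \<in> Fil k \<Longrightarrow> g \<in> Fil k \<Longrightarrow> f - g \<in> Fil k"
  using Fil_add[of f k "- g"] by (auto intro: Fil_minus)

lemma Fil_0 [simp, intro]: "0 \<in> Fil k"
  by (simp add: Fil_def)

text \<open>With truncated subtraction, \<open>(k - i) + (l - (n - i))\<close> is at least
  \<open>k + l - n\<close> for \<open>i \<le> n\<close>, so each product of coefficients carries
  enough factors p.\<close>

lemma Fil_mult: "f \<in> Fil k \<Longrightarrow> g \<in> Fil l \<Longrightarrow> f * g \<in> Fil (k + l)"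
proof -
  assume f: "f \<in> Fil k" and g: "g \<in> Fil l"
  have "p_integral p (coeff (f * g) n / of_nat p ^ (k + l - n))" for n
    unfolding coeff_mult sum_divide_distrib
  proof (rule integral_sum)
    fix i assume i: "i \<in> {..n}"
    have "p_integral p ((coeff f i / of_nat p ^ (k - i)) * (coeff g (n - i) / of_nat p ^ (l - (n - i))))"
      using f g unfolding Fil_def by (intro integral_mult) blast+
    then have "p_integral p (coeff f i * coeff g (n - i) / of_nat p ^ ((k - i) + (l - (n - i))))"
      by (simp add: power_add)
    then show "p_integral p (coeff f i * coeff g (n - i) / of_nat p ^ (k + l - n))"
      by (rule integral_p_times_div) (use i in auto)
  qed
  then show ?thesis by (simp add: Fil_def)
qed

lemma Fil_mono: "f \<in> Fil k \<Longrightarrow> l \<le> k \<Longrightarrow> f \<in> Fil l"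
  unfolding Fil_def using integral_p_times_div diff_le_mono by blast

lemma Fil_mult_0 [intro]: "f \<in> Fil 0 \<Longrightarrow> g \<in> Fil k \<Longrightarrow> f * g \<in> Fil k"
  using Fil_mult[of f 0 g k] by simp

lemma Fil_mult_0' [intro]: "f \<in> Fil k \<Longrightarrow> g \<in> Fil 0 \<Longrightarrow> f * g \<in> Fil k"
  using Fil_mult[of f k g 0] by simp

lemma Fil_const: "[:c:] \<in> Fil k \<longleftrightarrow> p_integral p (c / of_nat p ^ k)"
  unfolding Fil_def by (auto simp: coeff_pCons split: nat.split)

lemma Fil_1 [simp, intro]: "1 \<in> Fil 0"
  using Fil_const[of 1 0] by (simp add: one_pCons)

lemma Fil_power [intro]: "f \<in> Fil 0 \<Longrightarrow> f ^ n \<in> Fil 0"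
  by (induction n) auto

lemma Fil_of_nat [simp, intro]: "of_nat n \<in> Fil 0"
  by (induction n) auto

lemma Fil_numeral [simp, intro]: "numeral n \<in> Fil 0"
  using Fil_of_nat[of "numeral n"] by simp

lemma Fil_smult [intro]: "p_integral p c \<Longrightarrow> f \<in> Fil k \<Longrightarrow> smult c f \<in> Fil k"
  using Fil_mult_0[of "[:c:]" f k] Fil_const[of c 0] by simp

lemma Fil_sum [intro]: "(\<And>i. i \<in> A \<Longrightarrow> f i \<in> Fil k) \<Longrightarrow> sum f A \<in> Fil k"
  by (induction A rule: infinite_finite_induct) auto

lemma Fil_prod [intro]: "(\<And>i. i \<in> A \<Longrightarrow> f i \<in> Fil 0) \<Longrightarrow> prod f A \<in> Fil 0"
  by (induction A rule: infinite_finite_induct) auto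

lemma Fil_pochhammer [intro]: "f \<in> Fil 0 \<Longrightarrow> pochhammer f n \<in> Fil 0"
  unfolding pochhammer_prod by (intro Fil_prod Fil_add) auto

lemma Fil_pCons: "p_integral p (c / of_nat p ^ k) \<Longrightarrow> f \<in> Fil (k - 1) \<Longrightarrow> pCons c f \<in> Fil k"
  unfolding Fil_def by (auto simp: coeff_pCons split: nat.split)

section \<open>Congruences modulo the k-th power of (p, x)\<close>

definition fil_cong :: "nat \<Rightarrow> rat poly \<Rightarrow> rat poly \<Rightarrow> bool" where
  "fil_cong k f g \<longleftrightarrow> f - g \<in> Fil k"

lemma fil_cong_refl [simp, intro]: "fil_cong k f f"
  by (simp add: fil_cong_def)

lemma fil_cong_sym: "fil_cong k f g \<Longrightarrow> fil_cong k g f"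
  unfolding fil_cong_def using Fil_minus[of "f - g" k] by simp

lemma fil_cong_trans [trans]: "fil_cong k f g \<Longrightarrow> fil_cong k g h \<Longrightarrow> fil_cong k f h"
  unfolding fil_cong_def using Fil_add[of "f - g" k "g - h"] by simp

lemma fil_cong_Fil: "fil_cong k f g \<Longrightarrow> g \<in> Fil 0 \<Longrightarrow> f \<in> Fil 0"
  unfolding fil_cong_def using Fil_add[of "f - g" 0 g] Fil_mono[of "f - g" k 0] by simp

lemma fil_cong_mult_left: "fil_cong k f g \<Longrightarrow> h \<in> Fil l \<Longrightarrow> fil_cong (k + l) (h * f) (h * g)"
  unfolding fil_cong_def using Fil_mult[of h l "f - g" k] by (simp add: right_diff_distrib add.commute)

lemma fil_cong_mult:
  assumes "fil_cong k f g" "fil_cong k f' g'" "g \<in> Fil 0" "g' \<in> Fil 0"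
  shows "fil_cong k (f * f') (g * g')"
proof -
  have "f * f' - g * g' = f * (f' - g') + (f - g) * g'" by (simp add: algebra_simps)
  also have "\<dots> \<in> Fil k"
    using assms fil_cong_Fil[OF assms(1)] unfolding fil_cong_def by (intro Fil_add Fil_mult_0 Fil_mult_0') auto
  finally show ?thesis by (simp add: fil_cong_def)
qed

section \<open>Products of linear factors\<close>

text \<open>The rising factorial (y + 1) ... (y + m) divided by m!, normalised to start with 1 for
  expansion at small y.\<close>

definition E :: "rat poly \<Rightarrow> rat poly" where
  "E y = (\<Prod>i=1..m. 1 + smult (1 / of_nat i) y)"

definition H :: "nat \<Rightarrow> rat" where "H k = (\<Sum>i=1..k. 1 / of_nat i)"

text \<open>The second elementary symmetric function of 1, 1/2, ..., 1/k.\<close>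

definition H2 :: "nat \<Rightarrow> rat" where "H2 k = (\<Sum>i=1..k. H (i - 1) / of_nat i)"

abbreviation "h \<equiv> H m"

lemma integral_H: "k < p \<Longrightarrow> p_integral p (H k)"
  unfolding H_def by (intro integral_sum integral_inverse not_dvd_small) auto

lemma integral_H2: "k < p \<Longrightarrow> p_integral p (H2 k)"
  unfolding H2_def by (intro integral_sum integral_div not_dvd_small integral_H) auto

lemma integral_h [simp, intro]: "p_integral p h"
  by (rule integral_H) (simp add: p_eq)

lemma Fil_1_0 [intro]: "y \<in> Fil 1 \<Longrightarrow> y \<in> Fil 0"
  by (rule Fil_mono) auto

text \<open>Only the first two elementary symmetric functions of the 1/i survive, since
  \<open>y^3\<close> already lies in \<open>Fil 3\<close>.\<close>

lemma E_expand_aux: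
  assumes y: "y \<in> Fil 1" and "k < p"
  shows "fil_cong 3 (\<Prod>i=1..k. 1 + smult (1 / of_nat i) y) (1 + smult (H k) y + smult (H2 k) (y^2))"
  using assms(2)
proof (induction k)
  case 0
  show ?case by (simp add: H_def H2_def)
next
  case (Suc k)
  let ?c = "1 / of_nat (Suc k) :: rat"
  let ?P = "\<lambda>k. 1 + smult (H k) y + smult (H2 k) (y^2)"
  have c: "p_integral p ?c" using Suc.prems by (intro integral_inverse not_dvd_small) auto
  have y0: "y \<in> Fil 0" using y by blast
  have "fil_cong 3 ((\<Prod>i=1..k. 1 + smult (1 / of_nat i) y) * (1 + smult ?c y)) (?P k * (1 + smult ?c y))"
    by (rule fil_cong_mult) (use Suc y0 c in \<open>auto intro!: Fil_add Fil_smult integral_H integral_H2\<close>)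
  moreover have "fil_cong 3 (?P k * (1 + smult ?c y)) (?P (Suc k))"
  proof -
    have "H (Suc k) = H k + ?c" "H2 (Suc k) = H2 k + H k * ?c"
      by (simp_all add: H_def H2_def)
    then have "?P k * (1 + smult ?c y) - ?P (Suc k) = smult (?c * H2 k) (y * (y * y))"
      by (simp add: algebra_simps power2_eq_square smult_add_left)
    also have "y * (y * y) \<in> Fil (1 + (1 + 1))" by (intro Fil_mult y)
    then have "smult (?c * H2 k) (y * (y * y)) \<in> Fil 3"
      using c Suc.prems by (intro Fil_smult integral_mult integral_H2) (auto simp: numeral_3_eq_3)
    finally show ?thesis by (simp add: fil_cong_def)
  qed
  ultimately show ?case by (simp add: fil_cong_trans)
qed

lemmas E_expand = E_expand_aux[where k = m, folded E_def]

lemma prod_plus_eq_E: "(\<Prod>i=1..m. y + of_nat i) = smult (fact m) (E y)"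
proof -
  have "(\<Prod>i=1..m. y + of_nat i) = (\<Prod>i=1..m. smult (of_nat i) (1 + smult (1 / of_nat i) y))"
    by (rule prod.cong) (auto simp: smult_add_right of_nat_poly)
  also have "\<dots> = smult (\<Prod>i=1..m. of_nat i) (E y)"
    unfolding E_def by (simp add: prod_smult)
  finally show ?thesis by (simp add: fact_prod)
qed

lemma prod_minus_eq_E: "(\<Prod>i=1..m. y - of_nat i) = smult ((-1)^m * fact m) (E (- y))"
proof -
  have "(\<Prod>i=1..m. y - of_nat i) = (\<Prod>i=1..m. -1 * (- y + of_nat i))"
    by (rule prod.cong) auto
  also have "\<dots> = (-1)^m * (\<Prod>i=1..m. - y + of_nat i)"
    by (subst prod.distrib) simp
  also have "\<dots> = smult ((-1)^m) (\<Prod>i=1..m. - y + of_nat i)"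
    by (simp add: minus_one_power_iff)
  finally show ?thesis by (simp only: prod_plus_eq_E smult_smult)
qed

abbreviation (input) pp :: "rat poly" where "pp \<equiv> of_nat p"

text \<open>Both sides are \<open>(1 - y) ... (p - 1 - y)\<close> up to a common factor: the factors are grouped as
  \<open>{i, p - i}\<close> on the left and as \<open>{2 i, p - 2 i}\<close> on the right.\<close>

lemma E_reflect:
  "E (- y) * E (y - pp) = smult (4^m) (E (smult (-1/2) y) * E (smult (1/2) (y - pp)))"
proof -
  let ?g = "\<lambda>l. of_nat l - y"
  have "(\<Prod>i=1..m. ?g i * ?g (2*m+1-i)) = (\<Prod>i=1..m. (- y + of_nat i) * ((-1) * ((y - pp) + of_nat i)))"
    by (rule prod.cong) (auto simp: p_eq of_nat_diff)
  also have "\<dots> = smult ((-1)^m * fact m ^ 2) (E (- y) * E (y - pp))"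
    unfolding prod.distrib prod_plus_eq_E by (simp add: power2_eq_square minus_one_power_iff)
  finally have 1: "(\<Prod>i=1..m. ?g i * ?g (2*m+1-i)) = \<dots>" .
  have "(\<Prod>i=1..m. ?g (2*i) * ?g (2*m+1-2*i)) =
    (\<Prod>i=1..m. (smult 2 (smult (-1/2) y + of_nat i)) * (smult (-2) (smult (1/2) (y - pp) + of_nat i)))"
  proof (rule prod.cong)
    fix i assume "i \<in> {1..m}"
    then have "?g (2*m+1-2*i) = smult (-2) (smult (1/2) (y - pp) + of_nat i)"
      by (intro poly_eq_poly_eq_iff[THEN iffD1] ext) (simp add: p_eq of_nat_diff algebra_simps)
    moreover have "?g (2*i) = smult 2 (smult (-1/2) y + of_nat i)"
      by (intro poly_eq_poly_eq_iff[THEN iffD1] ext) (simp add: algebra_simps)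
    ultimately show "?g (2*i) * ?g (2*m+1-2*i) =
      smult 2 (smult (-1/2) y + of_nat i) * smult (-2) (smult (1/2) (y - pp) + of_nat i)"
      by (simp only:)
  qed simp
  also have "\<dots> = smult (2^m * (-2)^m * fact m ^ 2) (E (smult (-1/2) y) * E (smult (1/2) (y - pp)))"
    unfolding prod.distrib prod_smult prod_plus_eq_E by (simp add: power2_eq_square mult_ac)
  also have "(2::rat)^m * (-2)^m = (-1)^m * 4^m"
    by (simp flip: power_mult_distrib)
  finally have 2: "(\<Prod>i=1..m. ?g (2*i) * ?g (2*m+1-2*i)) =
    smult ((-1)^m * fact m ^ 2) (smult (4^m) (E (smult (-1/2) y) * E (smult (1/2) (y - pp))))"
    by (simp add: mult_ac)
  have "smult ((-1)^m * fact m ^ 2) (E (- y) * E (y - pp)) =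
    smult ((-1)^m * fact m ^ 2) (smult (4^m) (E (smult (-1/2) y) * E (smult (1/2) (y - pp))))"
    using 1 2 prod_pair_reflect[of ?g m] prod_pair_even[of ?g m] by simp
  then show ?thesis
    by (metis (no_types, lifting) fact_nonzero mult_eq_0_iff power_not_zero smult_cancel zero_neq_neg_one)
qed

lemma not_dvd_power2: "\<not> p dvd 2 ^ k"
  using not_dvd_2 prime_p prime_dvd_power by blast

lemma integral_div_power2:
  assumes "p_integral p r"
  shows "p_integral p (r / 2)" "p_integral p (r / 4)" "p_integral p (r / 8)" "p_integral p (r / 16)"
    "p_integral p (r / 32)" "p_integral p (r / 64)"
  using integral_div[OF assms not_dvd_power2[of 1]] integral_div[OF assms not_dvd_power2[of 2]]
    integral_div[OF assms not_dvd_power2[of 3]] integral_div[OF assms not_dvd_power2[of 4]]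
    integral_div[OF assms not_dvd_power2[of 5]] integral_div[OF assms not_dvd_power2[of 6]]
  by simp_all

lemma integral_div_3: "p_integral p r \<Longrightarrow> p_integral p (r / 3)"
  using integral_div[OF _ not_dvd_3] by simp

lemmas integral_intros =
  integral_add integral_diff integral_minus integral_mult integral_power integral_div_power2 integral_div_3
  integral_h integral_of_nat integral_numeral integral_0 integral_1

lemma p_nonzero [simp]: "p \<noteq> 0" "0 < p"
  using p_gt_3 by simp_all

lemma Fil_pp: "[:k * of_nat p:] \<in> Fil 1" if "p_integral p k"
  using that by (simp add: Fil_const)

lemma fil_cong_const: "fil_cong k [:a:] [:b:] \<longleftrightarrow> p_integral p ((a - b) / of_nat p ^ k)"
  by (simp add: fil_cong_def Fil_const)

lemma const_Fil_0: "[:a:] \<in> Fil 0 \<longleftrightarrow> p_integral p a"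
  by (simp add: Fil_const)

lemma E_const:
  assumes "p_integral p k"
  shows "fil_cong 3 (E [:k * of_nat p:]) [:1 + h * (k * of_nat p) + H2 m * (k * of_nat p)^2:]"
proof -
  have "m < p" by (simp add: p_eq)
  from E_expand[OF Fil_pp[OF assms] this]
  show ?thesis by (simp add: one_pCons power2_eq_square)
qed

lemma E_0: "E 0 = 1"
  by (simp add: E_def)

text \<open>Comparing the cases \<open>y = 0\<close> and \<open>y = - p\<close> of \<open>E_reflect\<close> up to second order replaces
  Wolstenholme-type congruences.\<close>

lemma H2_cong: "p_integral p ((H2 m - h^2 / 2) / of_nat p)"
proof -
  let ?p = "of_nat p :: rat"
  define e where "e = H2 m"
  have e: "p_integral p e" unfolding e_def by (rule integral_H2) (simp add: p_eq)
  note intr = integral_intros e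
  have pp: "pp = [:?p:]" by (simp add: of_nat_poly)
  have 1: "E [:(-1) * ?p:] = smult (4^m) (E [:(-1/2) * ?p:])"
    using E_reflect[of 0] by (simp add: pp E_0)
  have 2: "E [:1 * ?p:] * E [:(-2) * ?p:] = smult (4^m) (E [:(1/2) * ?p:] * E [:(-1) * ?p:])"
    using E_reflect[of "- pp"] by (simp add: pp)
  \<comment> \<open>Multiplying \<open>2\<close> by E(-p/2) and applying \<open>1\<close> eliminates
    \<open>4^m\<close>. The linear terms of both sides then agree, and the quadratic ones differ by
    3 (e - h^2/2).\<close>
  have eq: "E [:1 * ?p:] * E [:(-2) * ?p:] * E [:(-1/2) * ?p:] = E [:(1/2) * ?p:] * (E [:(-1) * ?p:] * E [:(-1) * ?p:])"
    unfolding 2 by (subst (3) 1) (simp add: mult_ac)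
  let ?Q = "\<lambda>k. [:1 + h * (k * ?p) + e * (k * ?p)^2:]"
  have Q: "?Q k \<in> Fil 0" if "p_integral p k" for k
    unfolding const_Fil_0 using that by (intro intr)
  have k: "p_integral p (-2)" "p_integral p (-1)" "p_integral p 1" "p_integral p (1/2)" "p_integral p (-1/2)"
    using integral_minus[OF integral_numeral[of "num.Bit0 num.One"]] integral_minus[OF integral_1] by (auto intro: intr)
  note E = E_const[folded e_def]
  have "fil_cong 3 (E [:1 * ?p:] * E [:(-2) * ?p:] * E [:(-1/2) * ?p:]) (?Q 1 * ?Q (-2) * ?Q (-1/2))"
    by (intro fil_cong_mult E Q Fil_mult_0 k)
  moreover have "fil_cong 3 (E [:(1/2) * ?p:] * (E [:(-1) * ?p:] * E [:(-1) * ?p:])) (?Q (1/2) * (?Q (-1) * ?Q (-1)))"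
    by (intro fil_cong_mult E Q Fil_mult_0 k)
  ultimately have "fil_cong 3 (?Q 1 * ?Q (-2) * ?Q (-1/2)) (?Q (1/2) * (?Q (-1) * ?Q (-1)))"
    unfolding eq by (meson fil_cong_sym fil_cong_trans)
  then have *: "p_integral p (((1 + h * ?p + e * ?p^2) * (1 - 2 * h * ?p + 4 * e * ?p^2) * (1 - h * ?p / 2 + e * ?p^2 / 4)
      - (1 + h * ?p / 2 + e * ?p^2 / 4) * (1 - h * ?p + e * ?p^2)^2) / ?p^3)" (is "p_integral p (?A / _)")
    by (simp add: fil_cong_const power2_eq_square mult_ac)
  \<comment> \<open>All contributions of order p^3 or higher, divided by p^3.\<close>
  define Z where "Z = 3*e*h/4 - 3*e*h^2*?p/4 - 3*e^2*h*?p^2/2 + 15*e^2*?p/4 + 3*e^3*?p^3/4 + h^3/2"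
  have "p_integral p Z" unfolding Z_def by (intro intr)
  have "?A = ?p^2 * (3 * (e - h^2/2)) + ?p^3 * Z"
    unfolding Z_def by (simp add: field_simps power2_eq_square power3_eq_cube)
  moreover have "u / ?p = ((?p^2 * (3 * u) + ?p^3 * Z) / ?p^3 - Z) / 3" for u
    by (simp add: field_simps power2_eq_square power3_eq_cube)
  ultimately have "(e - h^2/2) / ?p = (?A / ?p^3 - Z) / 3" by (simp only:)
  then show ?thesis
    using * \<open>p_integral p Z\<close> unfolding e_def[symmetric] by (simp only:) (intro intr)
qed

text \<open>The exponential of \<open>h * y\<close>, truncated after the second order.\<close>

definition X :: "rat poly \<Rightarrow> rat poly" where
  "X y = 1 + smult h y + smult (h^2 / 2) (y^2)"

lemma X_Fil [intro]: "y \<in> Fil 0 \<Longrightarrow> X y \<in> Fil 0"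
  unfolding X_def by (intro Fil_add Fil_smult Fil_1 Fil_power integral_intros)

text \<open>Replacing \<open>H2 m\<close> by \<open>h^2 / 2\<close> costs a multiple of p times
  \<open>y^2\<close>, which has order three.\<close>

lemma E_cong_X:
  assumes y: "y \<in> Fil 1"
  shows "fil_cong 3 (E y) (X y)"
proof -
  have "fil_cong 3 (E y) (1 + smult h y + smult (H2 m) (y^2))"
    by (rule E_expand[OF y]) (simp add: p_eq)
  moreover have "fil_cong 3 (1 + smult h y + smult (H2 m) (y^2)) (X y)"
  proof -
    have "1 + smult h y + smult (H2 m) (y^2) - X y = [:H2 m - h^2/2:] * (y * y)"
      by (simp add: X_def smult_diff_left power2_eq_square)
    moreover have "\<dots> \<in> Fil (1 + (1 + 1))"
      using H2_cong by (intro Fil_mult y) (simp add: Fil_const)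
    ultimately show ?thesis by (simp add: fil_cong_def numeral_3_eq_3)
  qed
  ultimately show ?thesis by (rule fil_cong_trans)
qed

lemma X_mult:
  assumes y: "y \<in> Fil 1" and z: "z \<in> Fil 1"
  shows "fil_cong 3 (X y * X z) (X (y + z))"
proof -
  have "X y * X z - X (y + z) =
    smult (h^3/2) (y * (y * z) + y * (z * z)) + smult (h^4/4) (y * (y * (z * z)))"
    by (intro poly_eq_poly_eq_iff[THEN iffD1] ext) (simp add: X_def field_simps power2_eq_square power3_eq_cube power4_eq_xxxx)
  also have "\<dots> \<in> Fil 3"
  proof (intro Fil_add Fil_smult)
    have "y * (y * z) \<in> Fil (1 + (1 + 1))" "y * (z * z) \<in> Fil (1 + (1 + 1))" by (intro Fil_mult y z)+
    then show "y * (y * z) \<in> Fil 3" "y * (z * z) \<in> Fil 3" by (simp_all add: numeral_3_eq_3)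
    have "y * (y * (z * z)) \<in> Fil (1 + (1 + (1 + 1)))" by (intro Fil_mult y z)
    then show "y * (y * (z * z)) \<in> Fil 3" by (rule Fil_mono) simp
  qed (intro integral_intros)+
  finally show ?thesis by (simp add: fil_cong_def)
qed

text \<open>Multiplying by \<open>E y\<close> adds \<open>y\<close> to the exponent, so a product of
  values of \<open>E\<close> is determined to third order by the sum of their arguments.\<close>

lemma fil_cong_E_step:
  assumes "fil_cong 3 f (X z)" "y \<in> Fil 1" "z \<in> Fil 1"
  shows "fil_cong 3 (E y * f) (X (y + z))"
proof -
  have "fil_cong 3 (E y * f) (X y * X z)"
    by (intro fil_cong_mult E_cong_X assms X_Fil Fil_1_0)
  then show ?thesis using X_mult[OF assms(2,3)] by (rule fil_cong_trans)
qed

text \<open>At y = 0, \<open>E_reflect\<close> reads E(-p) = 4^m E(-p/2), and 4^m = 2^(p-1) = 1 + p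
  q. Expanding both sides modulo p^3 relates h to q.\<close>

lemma fermat_quot:
  defines "q \<equiv> fermat_quot2 p"
  shows "p_integral p q" "p_integral p ((h - (- 2 * q + of_nat p * q^2)) / of_nat p ^ 2)"
proof -
  let ?p = "of_nat p :: rat"
  have pp: "pp = [:?p:]" by (simp add: of_nat_poly)
  have k: "p_integral p (-1)" "p_integral p (-1/2)"
    using integral_minus[OF integral_1] by (auto intro: integral_intros)
  define A B where "A = 1 - h * ?p + h^2 * ?p^2 / 2" and "B = 1 - h * ?p / 2 + h^2 * ?p^2 / 8"
  have 4: "(4::rat)^m = 1 + ?p * q"
    by (simp add: q_def fermat_quot2_def p_eq power_mult)
  have E1: "E [:(-1) * ?p:] = smult (4^m) (E [:(-1/2) * ?p:])"
    using E_reflect[of 0] by (simp add: pp E_0)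
  have "X [:(-1) * ?p:] = [:A:]" "X [:(-1/2) * ?p:] = [:B:]"
    by (simp_all add: X_def A_def B_def one_pCons power2_eq_square)
  then have A: "fil_cong 3 (E [:(-1) * ?p:]) [:A:]" and B: "fil_cong 3 (E [:(-1/2) * ?p:]) [:B:]"
    using E_cong_X[OF Fil_pp[OF k(1)]] E_cong_X[OF Fil_pp[OF k(2)]] by simp_all
  have iB: "p_integral p B" unfolding B_def by (intro integral_intros)
  have 44: "p_integral p (4^m)" by (intro integral_intros)
  have "fil_cong 3 (smult (4^m) (E [:(-1/2) * ?p:])) [:4^m * B:]"
    using fil_cong_mult[OF fil_cong_refl[of _ "[:4^m:]"] B] iB 44 by (simp add: const_Fil_0 mult.commute)
  with A have "fil_cong 3 [:A:] [:4^m * B:]"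
    unfolding E1 by (meson fil_cong_sym fil_cong_trans)
  then have AB: "p_integral p ((A - 4^m * B) / ?p^3)" by (simp add: fil_cong_const)
  have "p_integral p ((A - 4^m * B) / ?p^3 * ?p^2)"
    by (intro integral_mult[OF AB] integral_intros)
  then have AB1: "p_integral p ((A - 4^m * B) / ?p)"
    by (simp add: power2_eq_square power3_eq_cube)
  \<comment> \<open>The integrality of \<open>q\<close> comes out of the same congruence, divided by
    p, without Fermat's little theorem.\<close>
  have "q = - ((A - 4^m * B) / ?p) + ((- h + h^2 * ?p / 2) - 4^m * (- h / 2 + h^2 * ?p / 8))"
    using 4 by (simp add: A_def B_def field_simps power2_eq_square)
  then show q: "p_integral p q" using AB1 44 by (simp only:) (intro integral_intros; assumption)
  define d where "d = h + 2 * q"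
  have d: "p_integral p d" unfolding d_def by (intro integral_intros q)
  note intr = integral_intros q d
  \<comment> \<open>The congruence solved for d = h + 2 q: this shows one factor p; a second
    comparison fixes the quotient \<open>d'\<close> modulo p.\<close>
  have eq: "d = ?p * (2 * (3 * h^2/8 + q * h/2) - ?p * q * h^2/4 - ?p * (2 * ((A - 4^m * B) / ?p^3)))"
    unfolding 4 by (simp add: d_def A_def B_def field_simps power2_eq_square power3_eq_cube)
  define d' where "d' = 2 * (3 * h^2/8 + q * h/2) - ?p * q * h^2/4 - ?p * (2 * ((A - 4^m * B) / ?p^3))"
  have d': "p_integral p d'" unfolding d'_def by (intro intr AB)
  have dd: "d = ?p * d'" using eq by (simp only: d'_def)
  have "(h - (- 2 * q + ?p * q^2)) / ?p^2 = (d - ?p * q^2) / ?p^2" by (simp add: d_def)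
  also have "\<dots> = (d' - q^2) / ?p" by (simp add: dd power2_eq_square field_simps)
  also have "\<dots> = (2 * (3 * h^2/8 + q * h/2) - q^2) / ?p - q * h^2/4 - 2 * ((A - 4^m * B) / ?p^3)"
    by (simp add: d'_def field_simps)
  \<comment> \<open>The left side vanishes at h = -2 q, hence is divisible by d, and so by
    p.\<close>
  also have "2 * (3 * h^2/8 + q * h/2) - q^2 = d * (3 * d/4 - 2 * q)"
    by (simp add: d_def field_simps power2_eq_square)
  also have "d * (3 * d/4 - 2 * q) / ?p = d' * (3 * d/4 - 2 * q)" by (simp add: dd)
  finally have "(h - (- 2 * q + ?p * q^2)) / ?p^2 = d' * (3 * d/4 - 2 * q) - q * h^2/4 - 2 * ((A - 4^m * B) / ?p^3)" .
  then show "p_integral p ((h - (- 2 * q + ?p * q^2)) / ?p^2)"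
    by (simp only:) (intro intr d' AB)
qed

section \<open>Factorisation of the boundary terms\<close>

abbreviation (input) w :: "rat poly" where "w \<equiv> [:of_nat p / 2, -1:]"
abbreviation (input) w' :: "rat poly" where "w' \<equiv> [:of_nat p / 2, 1:]"

lemma Fil_av: "av \<in> Fil 0"
  by (intro Fil_pCons) (auto intro: integral_intros)

lemma Fil_w: "w \<in> Fil 1" "w' \<in> Fil 1" "pp \<in> Fil 1"
  using integral_minus[OF integral_1]
  by (auto intro!: Fil_pCons integral_intros simp: of_nat_poly)

lemmas Fil_intros = Fil_add Fil_diff Fil_minus Fil_mult_0 Fil_power Fil_numeral Fil_of_nat Fil_1 Fil_pochhammer
  Fil_av Fil_1_0[OF Fil_w(1)] Fil_1_0[OF Fil_w(2)] Fil_1_0[OF Fil_w(3)]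

lemma integral_minus1_power: "p_integral p ((-1)^k)"
  by (intro integral_intros)

lemma integral_fact: "p_integral p (fact k)"
  using integral_of_nat[of "fact k"] by simp

text \<open>For \<open>n < m\<close> the argument \<open>2 * n + 1\<close> stays below p, so the
  denominator of \<open>term_coeff n\<close> is prime to p.\<close>

lemma T_poly_Fil:
  assumes "n < m"
  shows "T_poly n \<in> Fil 0"
proof -
  have "p_integral p (term_coeff n)"
  proof -
    have "term_coeff n = (-1)^n * fact (3*n) / 3 / fact n / fact n / fact n / fact (2*n+1) / fact (2*n+1) / fact (2*n+1)"
      by (simp add: term_coeff_def power3_eq_cube)
    also have "p_integral p \<dots>"
      using assms by (intro integral_div_fact integral_div_3 integral_mult integral_minus1_power integral_fact) (auto simp: p_eq)
    finally show ?thesis .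
  qed
  moreover have "term_core n av \<in> Fil 0"
    unfolding term_core_def wz_cert0_def by (intro Fil_intros)
  ultimately show ?thesis unfolding T_poly_def by (rule Fil_smult)
qed

lemma fact_div_p: "k \<ge> p \<Longrightarrow> p_integral p (fact k / of_nat p)"
proof -
  assume "k \<ge> p"
  then have "p dvd fact k" using prime_p by (simp add: prime_dvd_fact_iff)
  then obtain c where "fact k = p * c" by (auto elim: dvdE)
  then have "(fact k :: rat) = of_nat p * of_nat c" by (metis of_nat_fact of_nat_mult)
  then show ?thesis by simp
qed

lemma fact_p: "(fact (2*m+1) :: rat) = of_nat p * fact (2*m)"
  by (simp add: p_eq)

lemma av_m: "1 - av + of_nat m = w" "av + of_nat m = w'" "- av + of_nat (Suc m) = w"
  by (simp_all add: p_eq of_nat_poly one_pCons field_simps)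

text \<open>Each \<open>fact (2 * m + 1)\<close> in the denominator contains p once, and the
  numerator factorial contains p since \<open>3 * m + 2 - j \<ge> p\<close>; hence p^2 clears the
  rest. Three factors \<open>w\<close> end the cubed rising factorial, one sits inside
  \<open>pochhammer (- av) (2 * Suc m + j)\<close>, and \<open>w'\<close> ends
  \<open>pochhammer av (Suc m)\<close>.\<close>

lemma F_poly_factor:
  assumes j: "1 \<le> j" "j \<le> m"
  shows "\<exists>U\<in>Fil 0. smult (of_nat p ^ 2) (F_poly (Suc m) j) = w^4 * w' * U"
proof -
  define c where "c = of_nat p ^ 2 * wz_f_coeff (Suc m) j"
  define q where "q = (av + of_nat (Suc m) - 2 * of_nat j) * pochhammer (1 - av + of_nat j) (m - j) ^ 3
     * (pochhammer (- av) (Suc m) * pochhammer (w + 1) (m + j)) * pochhammer av m"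
  have e: "3 * Suc m - j - 1 \<ge> p" using j by (simp add: p_eq)
  have "c = (-1)^Suc m * (fact (3 * Suc m - j - 1) / of_nat p) / fact (Suc m - j) / fact (Suc m - j) / fact (Suc m - j)
      / fact (2*m) / fact (2*m) / fact (2*m)"
    unfolding c_def wz_f_coeff_def using fact_p by (simp add: power3_eq_cube power2_eq_square field_simps)
  also have "p_integral p \<dots>"
    using j by (intro integral_div_fact integral_mult integral_minus1_power fact_div_p e) (auto simp: p_eq)
  finally have c: "p_integral p c" .
  have q: "q \<in> Fil 0" unfolding q_def by (intro Fil_intros)
  have 1: "pochhammer (1 - av + of_nat j) (Suc m - j) = pochhammer (1 - av + of_nat j) (m - j) * w"
  proof -
    have "of_nat j + of_nat (m - j) = (of_nat m :: rat poly)" using j by (simp flip: of_nat_add)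
    then have "1 - av + of_nat j + of_nat (m - j) = w" unfolding add.assoc using av_m(1) by (simp only:)
    then show ?thesis using j by (simp only: Suc_diff_le pochhammer_Suc)
  qed
  have 2: "pochhammer (- av) (2 * Suc m + j) = pochhammer (- av) (Suc m) * (w * pochhammer (w + 1) (m + j))"
    by (rule pochhammer_split[OF av_m(3)]) simp
  have 3: "pochhammer av (Suc m) = pochhammer av m * w'"
    by (simp only: pochhammer_Suc av_m)
  have "wz_f_core (Suc m) j av = w^4 * w' * q"
    unfolding wz_f_core_def 1 2 3 q_def by algebra
  then have "smult (of_nat p ^ 2) (F_poly (Suc m) j) = w^4 * w' * smult c q"
    unfolding F_poly_def c_def by (simp only: smult_smult mult_smult_right)
  then show ?thesis using Fil_smult[OF c q] by blast
qed

text \<open>The signed central binomial coefficient, equal to E(-p) by \<open>E_minus_pp\<close>.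
  Its square turns the leftover factorials of the boundary terms into values of
  \<open>E\<close>.\<close>

definition \<epsilon> :: rat where "\<epsilon> = (-1)^m * fact (2*m) / fact m ^ 2"

section \<open>Rising factorials and factorials expressed through E\<close>

lemma poch_E:
  "pochhammer (1 - av) m = smult ((-1)^m * fact m) (E (- w))"
  "pochhammer av m = smult ((-1)^m * fact m) (E (- w'))"
proof -
  have *: "z + of_nat (m - i) = z + of_nat m - of_nat i" if "i \<in> {1..m}" for i and z :: "rat poly"
    using that by (simp add: of_nat_diff)
  show "pochhammer (1 - av) m = smult ((-1)^m * fact m) (E (- w))"
    unfolding pochhammer_prod_rev prod_minus_eq_E[symmetric] av_m(1)[symmetric]
    by (rule prod.cong) (simp_all only: *)
  show "pochhammer av m = smult ((-1)^m * fact m) (E (- w'))"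
    unfolding pochhammer_prod_rev prod_minus_eq_E[symmetric] av_m(2)[symmetric]
    by (rule prod.cong) (simp_all only: *)
qed

lemma pochhammer_Suc_shift: "pochhammer (y + 1) k = (\<Prod>i=1..k. y + of_nat i)"
  by (induction k) (simp_all add: pochhammer_Suc add_ac)

lemma poch_m_E: "pochhammer (y + 1) m = smult (fact m) (E y)"
  unfolding pochhammer_Suc_shift by (rule prod_plus_eq_E)

lemma poch_2m_E: "pochhammer (y + 1) (2*m) = smult ((-1)^m * fact m ^ 2) (E y * E (- (y + pp)))"
proof -
  have "pochhammer (y + 1) (2*m) = (\<Prod>i=1..m. (y + of_nat i) * (y + of_nat (2*m+1-i)))"
    unfolding pochhammer_Suc_shift by (rule prod_pair_reflect)
  also have "\<dots> = (\<Prod>i=1..m. (y + of_nat i) * ((y + pp) - of_nat i))"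
    by (rule prod.cong) (auto simp: p_eq of_nat_diff)
  also have "\<dots> = smult (fact m) (E y) * smult ((-1)^m * fact m) (E (- (y + pp)))"
    by (simp only: prod.distrib prod_plus_eq_E prod_minus_eq_E)
  finally show ?thesis by (simp add: power2_eq_square mult_ac)
qed

lemma E_minus_pp: "E (- pp) = [:\<epsilon>:]"
proof -
  have "[:fact (2*m):] = smult ((-1)^m * fact m ^ 2) (E (- pp))"
    using poch_2m_E[of 0] by (simp add: E_0 fact_poly flip: pochhammer_fact)
  then have "smult (1 / ((-1)^m * fact m ^ 2)) [:fact (2*m):] = E (- pp)" by simp
  moreover have "1 / ((-1)^m * fact m ^ 2) * fact (2*m) = \<epsilon>"
    unfolding \<epsilon>_def by (cases "even m") simp_all
  ultimately show ?thesis by (metis smult_pCons smult_0_right)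
qed

lemma fact_E_pp: "[:fact (3*m+1):] = smult (fact (2*m+1) * fact m) (E pp)"
proof -
  have "(fact (3*m+1) :: rat poly) = pochhammer 1 ((2*m+1) + m)"
    by (simp add: pochhammer_fact)
  also have "\<dots> = fact (2*m+1) * pochhammer (pp + 1) m"
  proof -
    have "1 + of_nat (2*m+1) = pp + 1" by (simp add: p_eq)
    then show ?thesis unfolding pochhammer_product' pochhammer_fact by (simp only:)
  qed
  finally show ?thesis unfolding poch_m_E fact_poly by (simp del: fact_Suc add: mult.commute)
qed

lemma X_0: "X 0 = 1"
  by (simp add: X_def)

text \<open>The arguments p, p, -p, -p add up to 0, so \<open>E pp ^ 2\<close> inverts
  \<open>\<epsilon>^2\<close> to third order.\<close>

lemma eps_cancel:
  assumes "g \<in> Fil 0"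
  shows "fil_cong 3 (E pp * (E pp * (smult (\<epsilon>^2) g))) g"
proof -
  have "fil_cong 3 (E pp * (E pp * (E (- pp) * (E (- pp) * 1)))) (X (pp + (pp + (- pp + (- pp + 0)))))"
    by (intro fil_cong_E_step Fil_w Fil_minus Fil_add) (auto simp: X_0)
  then have "fil_cong 3 (E pp * (E pp * (E (- pp) * (E (- pp) * 1)))) 1"
    by (simp add: X_0)
  from fil_cong_mult[OF this fil_cong_refl, of g] assms
  have "fil_cong 3 (E pp * (E pp * (E (- pp) * (E (- pp) * 1))) * g) g" by simp
  also have "E pp * (E pp * (E (- pp) * (E (- pp) * 1))) * g = E pp * (E pp * (smult (\<epsilon>^2) g))"
    by (simp add: E_minus_pp power2_eq_square mult_ac)
  finally show ?thesis .
qed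

lemma eps_squared: "\<epsilon>^2 = fact (2*m) ^ 2 / fact m ^ 4"
  by (simp add: \<epsilon>_def power_divide power_mult_distrib flip: power_mult)

text \<open>For \<open>j = m + 1\<close> the linear factor \<open>a + n - 2 j\<close> is
  \<open>-w\<close>, and \<open>pochhammer (- av)\<close> contains \<open>w\<close> and ends with
  \<open>w + pp\<close>. The remaining rising factorials become values of \<open>E\<close> whose
  arguments cancel, leaving only \<open>- av\<close>.\<close>

lemma F_poly_diag:
  "\<exists>V. fil_cong 3 V (- av) \<and> smult (of_nat p ^ 2) (F_poly (Suc m) (Suc m)) = w^2 * (w + pp) * w' * V"
proof -
  define V where "V = smult ((-1)^m / fact (2*m) ^ 2)
    (- av * pochhammer (1 - av) m * pochhammer (w + 1) (2*m) * pochhammer av m)"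
  have V0: "V \<in> Fil 0"
  proof -
    have "(-1)^m / fact (2*m) ^ 2 = (-1)^m / fact (2*m) / (fact (2*m) :: rat)" by (simp add: power2_eq_square)
    also have "p_integral p \<dots>" by (intro integral_div_fact integral_minus1_power) (simp_all add: p_eq)
    finally show ?thesis unfolding V_def by (intro Fil_smult Fil_intros)
  qed
  have "smult (\<epsilon>^2) V = - av * (E (- w) * (E w * (E (- (w + pp)) * (E (- w') * 1))))"
  proof -
    have "smult (\<epsilon>^2) V = smult (\<epsilon>^2 * ((-1)^m / fact (2*m) ^ 2) * ((-1)^m * fact m) * ((-1)^m * fact m ^ 2) * ((-1)^m * fact m))
        (- av * (E (- w) * (E w * (E (- (w + pp)) * (E (- w') * 1)))))"
      unfolding V_def poch_E poch_2m_E
      by (simp only: mult_smult_left mult_smult_right smult_smult mult_1_right mult_1_left mult_ac)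
    also have "\<epsilon>^2 * ((-1)^m / fact (2*m) ^ 2) * ((-1)^m * fact m) * ((-1)^m * fact m ^ 2) * ((-1)^m * fact m) = 1"
      unfolding eps_squared by (cases "even m") (simp_all add: power4_eq_xxxx power2_eq_square)
    finally show ?thesis by simp
  qed
  then have "E pp * (E pp * smult (\<epsilon>^2) V) =
      - av * (E pp * (E pp * (E (- w) * (E w * (E (- (w + pp)) * (E (- w') * 1))))))"
    by (simp only: mult_ac)
  \<comment> \<open>The sum of the arguments is p - w - w' = 0.\<close>
  moreover have "fil_cong 3 (E pp * (E pp * (E (- w) * (E w * (E (- (w + pp)) * (E (- w') * 1))))))
      (X (pp + (pp + (- w + (w + (- (w + pp) + (- w' + 0)))))))"
    by (intro fil_cong_E_step Fil_w Fil_minus Fil_add) (auto simp: X_0)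
  then have "fil_cong 3 (E pp * (E pp * (E (- w) * (E w * (E (- (w + pp)) * (E (- w') * 1)))))) 1"
    by (simp add: X_0 of_nat_poly)
  then have "fil_cong 3 (- av * (E pp * (E pp * (E (- w) * (E w * (E (- (w + pp)) * (E (- w') * 1))))))) (- av)"
    using fil_cong_mult[OF fil_cong_refl[of 3 "- av"]] Fil_minus[OF Fil_av] Fil_1 by (metis mult_1_right)
  ultimately have "fil_cong 3 V (- av)"
    using eps_cancel[OF V0] by (metis fil_cong_sym fil_cong_trans)
  moreover have "smult (of_nat p ^ 2) (F_poly (Suc m) (Suc m)) = w^2 * (w + pp) * w' * V"
  proof -
    have 1: "pochhammer (- av) (2 * Suc m + Suc m) = (- av * pochhammer (1 - av) m) * (w * (pochhammer (w + 1) (2*m) * (w + pp)))"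
    proof -
      have "pochhammer (- av) (2 * Suc m + Suc m) = pochhammer (- av) (Suc m) * (w * pochhammer (w + 1) (Suc (2*m)))"
        by (rule pochhammer_split[OF av_m(3)]) simp
      moreover have "w + 1 + of_nat (2*m) = w + pp" by (simp add: p_eq)
      moreover have "pochhammer (- av) (Suc m) = - av * pochhammer (1 - av) m"
        unfolding pochhammer_rec by (simp only: add.commute diff_conv_add_uminus)
      ultimately show ?thesis by (simp only: pochhammer_Suc)
    qed
    have 2: "pochhammer av (Suc m) = pochhammer av m * w'"
      by (simp only: pochhammer_Suc av_m)
    have 3: "av + of_nat (Suc m) - 2 * of_nat (Suc m) = - w"
      by (simp add: p_eq of_nat_poly one_pCons numeral_poly field_simps)
    have core: "wz_f_core (Suc m) (Suc m) av =
      - (w^2 * (w + pp) * w' * (- av * pochhammer (1 - av) m * pochhammer (w + 1) (2*m) * pochhammer av m))"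
      unfolding wz_f_core_def 1 2 3 diff_self_eq_0 pochhammer_0 power_one by algebra
    have coeff: "of_nat p ^ 2 * wz_f_coeff (Suc m) (Suc m) = - ((-1)^m / fact (2*m) ^ 2)"
    proof -
      have "wz_f_coeff (Suc m) (Suc m) = - ((-1)^m / fact (2*m+1)^2)"
        by (simp add: wz_f_coeff_def power3_eq_cube power2_eq_square)
      then show ?thesis unfolding fact_p by (simp add: power_mult_distrib)
    qed
    show ?thesis
      unfolding F_poly_def smult_smult coeff core V_def mult_smult_right by simp
  qed
  ultimately show ?thesis by blast
qed

text \<open>Completes \<open>T_poly m\<close>: the two linear factors extend
  \<open>pochhammer (w + 1) (m - 2)\<close> to length \<open>m\<close>, \<open>3*m+1\<close> extends
  \<open>fact (3*m)\<close>, and 3 clears the denominator in \<open>term_coeff\<close>.\<close>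

definition D :: "rat poly" where
  "D = smult (3 * of_nat (3*m+1)) ((w + of_nat (m - 1)) * (w + of_nat m))"

lemma D_Fil: "D \<in> Fil 0"
  unfolding D_def by (intro Fil_smult Fil_intros integral_intros)

text \<open>As in \<open>F_poly_diag\<close>, but now the arguments add up to 3 p - 3 w - w' = p + 2
  x, so that a factor \<open>X\<close> remains.\<close>

lemma T_poly_last:
  "\<exists>U. fil_cong 3 (D * U) (- av * X [:of_nat p, 2:]) \<and> smult (of_nat p ^ 2) (T_poly m) = w * wz_cert0 (of_nat m) av * U"
proof -
  define c where "c = of_nat p ^ 2 * term_coeff m"
  define U where "U = smult c (- av * pochhammer (1 - av) m * pochhammer (w + 1) (m - 2) * pochhammer (1 - av) m ^ 3 * pochhammer av m)"
  have U0: "U \<in> Fil 0"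
  proof -
    have "c = (-1)^m * (fact (3*m) / of_nat p) / 3 / fact m / fact m / fact m / fact (2*m) / fact (2*m) / fact (2*m)"
      unfolding c_def term_coeff_def fact_p by (simp add: power3_eq_cube power2_eq_square field_simps)
    also have "p_integral p \<dots>"
      using m_ge_2 by (intro integral_div_fact integral_div_3 integral_mult integral_minus1_power fact_div_p) (auto simp: p_eq)
    finally show ?thesis unfolding U_def by (intro Fil_smult Fil_intros)
  qed
  let ?EE = "E (- w) * (E (- w) * (E (- w) * (E (- w) * (E w * (E (- w') * 1)))))"
  have "smult (\<epsilon>^2) (D * U) = - av * (E pp * ?EE)"
  proof -
    have pw: "pochhammer (w + 1) (m - 2) * ((w + of_nat (m - 1)) * (w + of_nat m)) = smult (fact m) (E w)"
    proof -
      obtain k where k: "m = Suc (Suc k)" using m_ge_2 by (metis Suc_le_D numeral_2_eq_2 Suc_le_mono)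
      have "w + 1 + of_nat k = w + of_nat (m - 1)" "w + 1 + of_nat (Suc k) = w + of_nat m"
        by (simp_all add: k add_ac)
      then have "pochhammer (w + 1) m = pochhammer (w + 1) k * (w + of_nat (m - 1)) * (w + of_nat m)"
        using k by (simp only: pochhammer_Suc)
      then show ?thesis unfolding poch_m_E using k by (simp only: diff_Suc_Suc diff_zero numeral_2_eq_2 mult.assoc)
    qed
    have "D * U = smult (3 * of_nat (3*m+1) * c) (- av * pochhammer (1 - av) m ^ 4 *
       (pochhammer (w + 1) (m - 2) * ((w + of_nat (m - 1)) * (w + of_nat m))) * pochhammer av m)"
      unfolding D_def U_def power4_eq_xxxx power3_eq_cube
      by (simp only: mult_smult_left mult_smult_right smult_smult mult_ac)
    also have "\<dots> = smult (3 * of_nat (3*m+1) * c * ((-1)^m * fact m)^4 * fact m * ((-1)^m * fact m)) (- av * ?EE)"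
      unfolding pw poch_E power4_eq_xxxx
      by (simp only: mult_smult_left mult_smult_right smult_smult mult_1_right mult_1_left mult_ac)
    also have "3 * of_nat (3*m+1) * c * ((-1)^m * fact m)^4 * fact m * ((-1)^m * fact m) =
        fact (3*m+1) / (fact (2*m+1) * fact m) * (fact m ^ 4 / fact (2*m)^2)"
    proof -
      have 1: "of_nat (3*m+1) * (fact (3*m) :: rat) = fact (3*m+1)" by simp
      have 2: "3 * k * (P * (s * f / (3 * x * y))) = s * P * (k * f) / (x * y)" for k P s f x y :: rat
        by simp
      have 3: "s * P^2 * f / (x^3 * (P * y)^3) * (s * x)^4 * x * (s * x) = f / (P * y * x) * (x^4 / y^2)"
        if "s = 1 \<or> s = -1" "P \<noteq> 0" "x \<noteq> 0" "y \<noteq> 0" for s P f x y :: rat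
        using that by (auto simp: field_simps power_numeral_reduce)
      have 4: "3 * of_nat (3*m+1) * c = (-1)^m * of_nat p ^ 2 * fact (3*m+1) / (fact m ^ 3 * fact (2*m+1)^3)"
        unfolding c_def term_coeff_def 2 1 ..
      show ?thesis unfolding 4 fact_p
        by (rule 3) (auto simp: minus_one_power_iff)
    qed
    also have "\<dots> = fact (3*m+1) / (fact (2*m+1) * fact m) / \<epsilon>^2"
      unfolding eps_squared by simp
    finally have DU: "D * U = smult (fact (3*m+1) / (fact (2*m+1) * fact m) / \<epsilon>^2) (- av * ?EE)" .
    have "\<epsilon> \<noteq> 0" by (simp add: \<epsilon>_def)
    then have "smult (\<epsilon>^2) (D * U) = smult (fact (3*m+1) / (fact (2*m+1) * fact m)) (- av * ?EE)"
      unfolding DU by simp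
    also have "\<dots> = [:fact (3*m+1) / (fact (2*m+1) * fact m):] * (- av * ?EE)" by simp
    also have "[:fact (3*m+1) / (fact (2*m+1) * fact m):] = E pp"
    proof -
      have "smult (1 / (fact (2*m+1) * fact m)) [:fact (3*m+1):] = E pp"
        unfolding fact_E_pp by simp
      then show ?thesis by simp
    qed
    finally show ?thesis by (simp only: mult_ac)
  qed
  then have "E pp * (E pp * (smult (\<epsilon>^2) (D * U))) = - av * (E pp * (E pp * (E pp * ?EE)))"
    by (simp only: mult_ac)
  moreover have "fil_cong 3 (E pp * (E pp * (E pp * ?EE)))
      (X (pp + (pp + (pp + (- w + (- w + (- w + (- w + (w + (- w' + 0))))))))))"
    by (intro fil_cong_E_step Fil_w Fil_minus Fil_add) (auto simp: X_0)
  then have "fil_cong 3 (E pp * (E pp * (E pp * ?EE))) (X [:of_nat p, 2:])"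
    by (simp add: of_nat_poly)
  then have "fil_cong 3 (- av * (E pp * (E pp * (E pp * ?EE)))) (- av * X [:of_nat p, 2:])"
    by (intro fil_cong_mult fil_cong_refl Fil_minus Fil_av X_Fil)
      (auto intro!: Fil_pCons)
  ultimately have "fil_cong 3 (D * U) (- av * X [:of_nat p, 2:])"
    using eps_cancel[OF Fil_mult_0[OF D_Fil U0]] by (metis fil_cong_sym fil_cong_trans)
  moreover have "smult (of_nat p ^ 2) (T_poly m) = w * wz_cert0 (of_nat m) av * U"
  proof -
    have 1: "pochhammer (- av) (2 * m) = (- av * pochhammer (1 - av) m) * (w * pochhammer (w + 1) (m - 2))"
    proof -
      have "pochhammer (- av) (2 * m) = pochhammer (- av) (Suc m) * (w * pochhammer (w + 1) (m - 2))"
        by (rule pochhammer_split[OF av_m(3)]) (use m_ge_2 in simp)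
      moreover have "pochhammer (- av) (Suc m) = - av * pochhammer (1 - av) m"
        unfolding pochhammer_rec by (simp only: add.commute diff_conv_add_uminus)
      ultimately show ?thesis by (simp only:)
    qed
    show ?thesis
      unfolding T_poly_def smult_smult term_core_def 1 U_def c_def
      by (simp only: mult_smult_left mult_smult_right mult_ac)
  qed
  ultimately show ?thesis by blast
qed

end

section \<open>Extraction of the constant term\<close>

text \<open>With m = (p - 1)/2 inserted, the coefficients of 1, x, x^2 visibly contain p^3, p^2, p;
  this is the source of \<open>wz_cert0_Fil\<close>.\<close>

lemma wz_cert0_list:
  fixes P :: rat
  shows "wz_cert0 [:(P - 1) / 2:] av = [:- 87*P^3/64 + 349*P^4/64 - 113*P^5/16 + 43*P^6/16,
    - 27*P^2/32 - 11*P^3/32 + 49*P^4/8 - 19*P^5/4,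
    27*P/16 - 189*P^2/16 + 279*P^3/16 - 81*P^4/16,
    - 9/8 + 87*P/8 - 237*P^2/8 + 147*P^3/8,
    - 3 + 57*P/4 - 63*P^2/4,
    - 3/2 + 9*P/2:]"
  by (intro poly_eq_poly_eq_iff[THEN iffD1] ext)
     (simp only: poly_wz_cert0 wz_cert0_def poly_pCons poly_0 poly_add poly_mult poly_diff poly_minus
        poly_smult poly_power poly_1 mult_zero_right
        add_0_right, simp add: divide_simps, algebra)

text \<open>The explicitly known polynomial \<open>R\<close> of \<open>sum_congruence\<close>, with
  \<open>P\<close> and \<open>h\<close> as free variables.\<close>

lemma correction_list:
  fixes P h :: rat
  defines "D \<equiv> smult (3 * ((3 * P - 1) / 2)) ([:P - 3/2, -1:] * [:P - 1/2, -1:])"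
    and "w \<equiv> [:P/2, -1:]" and "w' \<equiv> [:P/2, 1:]"
    and "Y \<equiv> 1 + smult h [:P, 2:] + smult (h^2 / 2) ([:P, 2:]^2)"
  shows "D * (w^2 * (w + [:P:]) * w') * av - w * wz_cert0 [:(P - 1) / 2:] av * (av * Y) =
   [:15*P^4/64 - 49*P^5/64 + 87*P^5*h/256 + 25*P^6/32 - 349*P^6*h/256 + 87*P^6*h^2/512 - P^7/4 +
       113*P^7*h/64 - 349*P^7*h^2/512 - 43*P^8*h/64 + 113*P^8*h^2/128 - 43*P^9*h^2/128,
    - 3*P^3/16 + 45*P^4/32 + 27*P^4*h/128 - 91*P^5/32 + 49*P^5*h/64 + 57*P^5*h^2/128 + 17*P^6/8 -
        545*P^6*h/128 - 251*P^6*h^2/256 - P^7/2 + 151*P^7*h/32 - 93*P^7*h^2/256 - 43*P^8*h/32 +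
        27*P^8*h^2/16 - 43*P^9*h^2/64,
    - 9*P^2/16 + 25*P^3/16 - 57*P^3*h/32 + P^4/16 + 565*P^4*h/64 - 87*P^4*h^2/128 - 35*P^5/16 -
        45*P^5*h/4 + 663*P^5*h^2/128 + 9*P^6/8 + 57*P^6*h/64 - 1265*P^6*h^2/128 + 19*P^7*h/8 +
        661*P^7*h^2/128 - 5*P^8*h^2/32,
    - 21*P^2/8 - 9*P^2*h/16 + 55*P^3/8 - 53*P^3*h/8 - 33*P^3*h^2/16 - 41*P^4/8 + 971*P^4*h/32 +
        353*P^4*h^2/64 + 7*P^5/8 - 515*P^5*h/16 + 251*P^5*h^2/64 + 253*P^6*h/32 - 973*P^6*h^2/64 +
        405*P^7*h^2/64,
    27*P*h/16 - 15*P^2/4 - 195*P^2*h/16 + 9*P^2*h^2/32 + 27*P^3/4 + 31*P^3*h/4 - 407*P^3*h^2/32 - 3*P^4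
        + 415*P^4*h/16 + 1095*P^4*h^2/32 - 299*P^5*h/16 - 615*P^5*h^2/32 - 23*P^6*h^2/16,
    57*P*h/4 + 9*P*h^2/8 - 3*P^2/2 - 411*P^2*h/8 - 81*P^2*h^2/16 + 3*P^3/2 + 45*P^3*h - 287*P^3*h^2/16 -
        9*P^4*h/4 + 775*P^4*h^2/16 - 317*P^5*h^2/16 - 9*h/8,
    36*P*h + 93*P*h^2/8 - 297*P^2*h/4 - 267*P^2*h^2/8 + 69*P^3*h/2 + 63*P^3*h^2/8 + 15*P^4*h^2 - 21*h/4
        - 9*h^2/8,
    33*P*h + 129*P*h^2/4 - 63*P^2*h/2 - 231*P^2*h^2/4 + 75*P^3*h^2/4 - 15*h/2 - 21*h^2/4,
    9*P*h + 63*P*h^2/2 - 27*P^2*h^2 - 3*h - 15*h^2/2,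
    9*P*h^2 - 3*h^2:]"
  unfolding D_def w_def w'_def Y_def wz_cert0_list
  by (intro poly_eq_poly_eq_iff[THEN iffD1] ext)
     (simp only: poly_pCons poly_0 poly_add poly_mult poly_diff poly_minus
        poly_smult poly_power poly_1 mult_zero_right
        add_0_right, simp add: divide_simps, algebra)

text \<open>The weights 1 and 3P/2 are chosen so that the coefficient of x in D U drops out when
  \<open>w^4 * w' * D * U\<close> is compared with \<open>R\<close>. The cubic factor in
  \<open>P\<close> is the constant coefficient of \<open>D\<close>.\<close>

lemma correction_coeffs:
  fixes P h :: rat
  defines "D \<equiv> smult (3 * ((3 * P - 1) / 2)) ([:P - 3/2, -1:] * [:P - 1/2, -1:])"
    and "w \<equiv> [:P/2, -1:]" and "w' \<equiv> [:P/2, 1:]"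
    and "Y \<equiv> 1 + smult h [:P, 2:] + smult (h^2 / 2) ([:P, 2:]^2)"
  defines "R \<equiv> D * (w^2 * (w + [:P:]) * w') * av - w * wz_cert0 [:(P - 1) / 2:] av * (av * Y)"
  shows "coeff R 5 + 3/2 * P * coeff R 6 - 3 * ((3 * P - 1) / 2) * ((P - 3/2) * (P - 1/2)) * (h + P * h^2/2)
    = P^2 * (- 3/2 + 3*P/2 - 567*P*h/8 - 251*P*h^2/4 + 99*P^2*h/2 + 58*P^2*h^2 + 43*P^3*h^2/16 + 105*h/8
        + 147*h^2/16)"
  unfolding R_def D_def w_def w'_def Y_def correction_list coeff_list10
  by (simp add: field_simps power_numeral_reduce)

context prime_gt_3
begin

abbreviation (input) P :: rat where "P \<equiv> of_nat p"

lemma of_nat_m: "(of_nat m :: rat) = (P - 1) / 2"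
  by (simp add: p_eq)

lemma of_nat_m_poly: "(of_nat m :: rat poly) = [:(P - 1) / 2:]"
  by (simp add: of_nat_poly of_nat_m)

lemma D_eq: "D = smult (3 * ((3 * P - 1) / 2)) ([:P - 3/2, -1:] * [:P - 1/2, -1:])"
proof -
  have "of_nat (3*m+1) = (3 * P - 1) / 2" by (simp add: of_nat_m field_simps)
  moreover have "w + of_nat (m - 1) = [:P - 3/2, -1:]" "w + of_nat m = [:P - 1/2, -1:]"
    using m_ge_2 by (simp_all add: of_nat_poly of_nat_diff of_nat_m field_simps)
  ultimately show ?thesis by (simp only: D_def)
qed

lemma wz_cert0_Fil: "wz_cert0 (of_nat m) av \<in> Fil 3"
proof -
  have "(- 87*P^3/64 + 349*P^4/64 - 113*P^5/16 + 43*P^6/16) / P^3 = - (87/64) + 349*P/64 - 113*P^2/16 +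
      43*P^3/16"
    "(- 27*P^2/32 - 11*P^3/32 + 49*P^4/8 - 19*P^5/4) / P^2 = - (27/32) - 11*P/32 + 49*P^2/8 - 19*P^3/4"
    "(27*P/16 - 189*P^2/16 + 279*P^3/16 - 81*P^4/16) / P = 27/16 - 189*P/16 + 279*P^2/16 - 81*P^3/16"
    by (simp_all add: field_simps power_numeral_reduce)
  moreover have "p_integral p (- (87/64) + 349*P/64 - 113*P^2/16 + 43*P^3/16)"
    "p_integral p (- (27/32) - 11*P/32 + 49*P^2/8 - 19*P^3/4)"
    "p_integral p (27/16 - 189*P/16 + 279*P^2/16 - 81*P^3/16)"
    "p_integral p (- (9/8) + 87*P/8 - 237*P^2/8 + 147*P^3/8)"
    "p_integral p (- 3 + 57*P/4 - 63*P^2/4)" "p_integral p (- (3/2) + 9*P/2)"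
    by (intro integral_intros)+
  ultimately show ?thesis
    unfolding of_nat_m_poly wz_cert0_list
    by (intro Fil_pCons) simp_all
qed

lemma w_power_list: "w^4 * w' = [:P^5/32, -3*P^4/16, P^3/4, P^2/2, -3*P/2, 1:]"
  by (intro poly_eq_poly_eq_iff[THEN iffD1] ext) (simp add: field_simps power_numeral_reduce)

text \<open>Up to a factor 8 the denominator is 3 (3p - 1)(2p - 3)(2p - 1), whose factors are 3, -1,
  -3, -1 modulo p.\<close>

lemma d0_inverse: "p_integral p (1 / (3 * ((3 * P - 1) / 2) * ((P - 3/2) * (P - 1/2))))"
proof -
  define N where "N = 3 * (3*p-1) * ((2*p-3) * (2*p-1))"
  have nd: "\<not> p dvd a * p - b" if "0 < b" "b < p" "a \<ge> 1" for a b
  proof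
    assume "p dvd a * p - b"
    moreover have "b \<le> a * p" using that by (metis less_imp_le_nat mult_le_mono1 nat_mult_1 order_trans)
    ultimately have "p dvd b" by (metis dvd_diffD1 dvd_triv_right)
    then show False using that by (auto dest: dvd_imp_le)
  qed
  have "\<not> p dvd N"
    using nd[of 1 3] nd[of 3 2] nd[of 1 2] not_dvd_3 p_gt_3 prime_p
    by (simp add: N_def prime_dvd_mult_iff)
  then have *: "p_integral p (8 / of_nat N)" by (intro integral_div integral_numeral)
  have "of_nat N = 3 * (3 * P - 1) * ((2 * P - 3) * (2 * P - 1))"
    using p_gt_3 by (simp add: N_def of_nat_diff)
  also have "\<dots> = 8 * (3 * ((3 * P - 1) / 2) * ((P - 3/2) * (P - 1/2)))"
    by (simp add: field_simps)
  finally have N: "of_nat N = 8 * (3 * ((3 * P - 1) / 2) * ((P - 3/2) * (P - 1/2)))" .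
  have "8 / (8 * d) = 1 / d" for d :: rat by simp
  then show ?thesis using * unfolding N by (simp only:)
qed

text \<open>Here \<open>u\<close> and \<open>v\<close> are the constant terms of U and V, weighted
  by the values p^5/32 of \<open>w^4 * w'\<close> and 3p^4/16 of \<open>w^2 * (w + pp) * w'\<close>
  at x = 0, over p^2.\<close>

lemma sum_congruence:
  "\<exists>u v. p_integral p ((u - (h + P * h^2 / 2)) / P^2) \<and> p_integral p ((v + 1/2) / P^3) \<and>
     (\<Sum>n\<le>m. poly (T_poly n) 0) = P^3 * u / 32 + 3 * P^2 * v / 16"
proof -
  obtain Uj where Uj: "\<And>j. 1 \<le> j \<Longrightarrow> j \<le> m \<Longrightarrow> Uj j \<in> Fil 0 \<and> smult (P^2) (F_poly (Suc m) j) = w^4 * w' * Uj j"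
    using F_poly_factor by metis
  define U where "U = (\<Sum>j=1..m. Uj j)"
  have U: "U \<in> Fil 0" unfolding U_def using Uj by (intro Fil_sum) auto
  have sumU: "smult (P^2) (\<Sum>j=1..m. F_poly (Suc m) j) = w^4 * w' * U"
    unfolding U_def sum_distrib_left smult_sum_right by (rule sum.cong) (use Uj in auto)
  obtain V where V: "fil_cong 3 V (- av)" "smult (P^2) (F_poly (Suc m) (Suc m)) = w^2 * (w + pp) * w' * V"
    using F_poly_diag by blast
  let ?K = "wz_cert0 (of_nat m) av"
  obtain U' where U': "fil_cong 3 (D * U') (- av * X [:P, 2:])" "smult (P^2) (T_poly m) = w * ?K * U'"
    using T_poly_last by blast
  define S where "S = (\<Sum>n<m. T_poly n)"
  have S: "S \<in> Fil 0" unfolding S_def by (intro Fil_sum T_poly_Fil) auto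
  have total: "smult (P^2) (\<Sum>n\<le>m. T_poly n) = w^4 * w' * U + w^2 * (w + pp) * w' * V"
  proof -
    have "(\<Sum>j=1..Suc m. F_poly (Suc m) j) = (\<Sum>j=1..m. F_poly (Suc m) j) + F_poly (Suc m) (Suc m)"
      by simp
    then show ?thesis unfolding T_poly_sum by (simp only: smult_add_right sumU V(2))
  qed
  have "(\<Sum>n\<le>m. T_poly n) = S + T_poly m"
    unfolding S_def by (simp flip: lessThan_Suc_atMost)
  \<comment> \<open>Both sides are p^2 times the full sum: on the left as a sum over
    \<open>n\<close>, on the right after telescoping.\<close>
  then have eq: "smult (P^2) S + w * ?K * U' = w^4 * w' * U + w^2 * (w + pp) * w' * V"
    using total U'(2) by (simp only: smult_add_right)

  define W where "W = D * U"
  define Q where "Q = w^2 * (w + pp) * w'"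
  define R where "R = D * Q * av - w * ?K * (av * X [:P, 2:])"
  have W: "W \<in> Fil 0" unfolding W_def by (intro Fil_mult_0 D_Fil U)
  have Q: "Q \<in> Fil 4"
  proof -
    have "w * w * (w + pp) * w' \<in> Fil (1 + 1 + 1 + 1)"
      by (intro Fil_mult Fil_w Fil_add)
    moreover have "1 + 1 + 1 + 1 = (4 :: nat)" by simp
    ultimately show ?thesis by (simp only: Q_def power2_eq_square)
  qed
  have wK: "w * ?K \<in> Fil 4"
    using Fil_mult[OF Fil_w(1) wz_cert0_Fil] by (simp only: one_plus_numeral add_num_simps)
  \<comment> \<open>The cofactors have order 4 and the congruences for \<open>U'\<close> and
    \<open>V\<close> order 3.\<close>
  have c1: "fil_cong 7 (w * ?K * (D * U')) (w * ?K * (- av * X [:P, 2:]))"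
    using fil_cong_mult_left[OF U'(1) wK] by (simp only: arith_simps)
  have c2: "fil_cong 7 (D * Q * V) (D * Q * (- av))"
    using fil_cong_mult_left[OF V(1) Fil_mult_0[OF D_Fil Q]] by (simp only: arith_simps)
  define C where "C = w^4 * w' * W - smult (P^2) (D * S) - R"
  have C: "C \<in> Fil 7"
  proof -
    have "w^4 * w' * W = D * (w^4 * w' * U)" unfolding W_def by (simp only: mult_ac)
    also have "w^4 * w' * U = smult (P^2) S + w * ?K * U' - Q * V"
      unfolding eq Q_def by (simp only: add_diff_cancel_right')
    also have "D * (smult (P^2) S + w * ?K * U' - Q * V) = smult (P^2) (D * S) + w * ?K * (D * U') - D *
        Q * V"
      by (simp only: distrib_left right_diff_distrib mult_smult_right mult_ac)
    finally have "C = (w * ?K * (D * U') - w * ?K * (- av * X [:P, 2:])) - (D * Q * V - D * Q * (- av))"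
      unfolding C_def R_def by (simp only:)
    also have "\<dots> \<in> Fil 7" using c1 c2 unfolding fil_cong_def by (rule Fil_diff)
    finally show ?thesis .
  qed
  define c where "c i = coeff W i" for i
  have c: "p_integral p (c i)" for i
    using W by (simp add: Fil_def c_def)
  define s5 s6 where "s5 = coeff (D * S) 5" and "s6 = coeff (D * S) 6"
  have s: "p_integral p s5" "p_integral p s6"
    using Fil_mult_0[OF D_Fil S] by (simp_all add: Fil_def s5_def s6_def)
  \<comment> \<open>In \<open>Fil 7\<close> the coefficients of x^5 and x^6 are divisible by p^2 and
    p.\<close>
  define e5 e6 where "e5 = coeff C 5 / P^2" and "e6 = coeff C 6 / P"
  have e: "p_integral p e5" "p_integral p e6"
    using C[unfolded Fil_def, simplified, rule_format, of 5] C[unfolded Fil_def, simplified, rule_format, of 6]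
    by (simp_all add: e5_def e6_def)
  \<comment> \<open>\<open>w^4 * w'\<close> is monic of degree 5 and its lower coefficients carry
    growing powers of p, so these two coefficients determine \<open>c 0\<close> modulo p^2 once
    \<open>c 1\<close> is eliminated.\<close>
  have "coeff (w^4 * w' * W) 5 = c 0 - 3*P/2 * c 1 + P^2/2 * c 2 + P^3/4 * c 3 - 3*P^4/16 * c 4 + P^5/32 *
      c 5"
    unfolding w_power_list coeff_mult c_def by (simp add: coeff_pCons eval_nat_numeral)
  then have m5: "P^2 * e5 = c 0 - 3*P/2 * c 1 + P^2/2 * c 2 + P^3/4 * c 3 - 3*P^4/16 * c 4 + P^5/32 * c 5
      - P^2 * s5 - coeff R 5"
    unfolding e5_def C_def s5_def by simp
  have "coeff (w^4 * w' * W) 6 = c 1 - 3*P/2 * c 2 + P^2/2 * c 3 + P^3/4 * c 4 - 3*P^4/16 * c 5 + P^5/32 *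
      c 6"
    unfolding w_power_list coeff_mult c_def by (simp add: coeff_pCons eval_nat_numeral)
  then have m6: "P * e6 = c 1 - 3*P/2 * c 2 + P^2/2 * c 3 + P^3/4 * c 4 - 3*P^4/16 * c 5 + P^5/32 * c 6 -
      P^2 * s6 - coeff R 6"
    unfolding e6_def C_def s6_def by simp
  define d0 where "d0 = 3 * ((3 * P - 1) / 2) * ((P - 3/2) * (P - 1/2))"
  define u where "u = coeff U 0"
  have c0: "c 0 = d0 * u"
    unfolding c_def W_def D_eq d0_def u_def by (simp add: coeff_mult_0)
  define Z where "Z = - 3/2 + 3*P/2 - 567*P*h/8 - 251*P*h^2/4 + 99*P^2*h/2 + 58*P^2*h^2 + 43*P^3*h^2/16 +
      105*h/8 + 147*h^2/16"
  define Y where "Y = e5 + s5 - c 2 / 2 - P * c 3 / 4 + 3 * P^2 * c 4 / 16 - P^3 * c 5 / 32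
     + 3 * (e6 + P * s6 + 3 * c 2 / 2 - P * c 3 / 2 - P^2 * c 4 / 4 + 3 * P^3 * c 5 / 16 - P^4 * c 6 /
         32) / 2"
  have ZY: "p_integral p (Z + Y)"
    unfolding Z_def Y_def by (intro integral_intros c s e)
  have RZ: "coeff R 5 + 3/2 * P * coeff R 6 - d0 * (h + P * h^2/2) = P^2 * Z"
    using correction_coeffs[of P h]
    unfolding R_def D_eq Q_def of_nat_m_poly X_def d0_def Z_def unfolding of_nat_poly .
  have m5': "c 0 = P^2 * e5 + 3*P/2 * c 1 - P^2/2 * c 2 - P^3/4 * c 3 + 3*P^4/16 * c 4 - P^5/32 * c 5 +
      P^2 * s5 + coeff R 5"
    using m5 by simp
  have m6': "c 1 = P * e6 + 3*P/2 * c 2 - P^2/2 * c 3 - P^3/4 * c 4 + 3*P^4/16 * c 5 - P^5/32 * c 6 + P^2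
      * s6 + coeff R 6"
    using m6 by simp
  \<comment> \<open>Inserting \<open>m6'\<close> for \<open>c 1\<close> in \<open>m5'\<close> leaves
    only multiples of p^2 besides the coefficients of \<open>R\<close>.\<close>
  have "d0 * u = P^2 * Y + coeff R 5 + 3/2 * P * coeff R 6"
    unfolding c0[symmetric] m5' m6' Y_def by (simp add: field_simps power_numeral_reduce)
  then have "d0 * (u - (h + P * h^2/2)) = P^2 * (Z + Y)"
    using RZ by (simp add: algebra_simps)
  moreover have "d0 \<noteq> 0"
  proof -
    have "P \<ge> 5" using p_eq m_ge_2 by simp
    then show ?thesis by (simp add: d0_def)
  qed
  ultimately have "(u - (h + P * h^2/2)) / P^2 = (Z + Y) * (1 / d0)"
    by (simp add: frac_eq_eq mult_ac)
  then have u: "p_integral p ((u - (h + P * h^2/2)) / P^2)"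
    using ZY d0_inverse unfolding d0_def by (simp only:) (intro integral_mult)
  have v: "p_integral p ((coeff V 0 + 1/2) / P^3)"
    using V(1)[unfolded fil_cong_def Fil_def, simplified, rule_format, of 0] by simp
  have "P^2 * (\<Sum>n\<le>m. poly (T_poly n) 0) = poly (smult (P^2) (\<Sum>n\<le>m. T_poly n)) 0"
    by (simp add: poly_sum)
  also have "\<dots> = P^5 / 32 * u + 3 * P^4 / 16 * coeff V 0"
    unfolding total u_def poly_0_coeff_0[symmetric] by (simp add: field_simps power_numeral_reduce)
  also have "\<dots> = P^2 * (P^3 * u / 32 + 3 * P^2 * coeff V 0 / 16)"
    by (simp add: field_simps power_numeral_reduce)
  finally have "(\<Sum>n\<le>m. poly (T_poly n) 0) = P^3 * u / 32 + 3 * P^2 * coeff V 0 / 16"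
    by simp
  with u v show ?thesis by blast
qed

text \<open>With v = -1/2 modulo p^3 the sum times -96 is 9 p^2 - 3 p^3 u modulo p^5. With h = -2 q
  + p q^2 modulo p^2, u becomes -2 q + 3 p q^2 modulo p^2.\<close>

lemma main_congruence:
  defines "q \<equiv> fermat_quot2 p"
  shows "p_integral p ((- 96 * (\<Sum>n\<le>m. poly (T_poly n) 0) - (9 * P^2 + 6 * P^3 * q - 9 * P^4 * q^2)) / P^5)"
proof -
  obtain u v where u: "p_integral p ((u - (h + P * h^2 / 2)) / P^2)" and v: "p_integral p ((v + 1/2) / P^3)"
    and sum: "(\<Sum>n\<le>m. poly (T_poly n) 0) = P^3 * u / 32 + 3 * P^2 * v / 16"
    using sum_congruence by blast
  define u' v' where "u' = (u - (h + P * h^2 / 2)) / P^2" and "v' = (v + 1/2) / P^3"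
  define h' where "h' = (h - (- 2 * q + P * q^2)) / P^2"
  define y where "y = q^2 + P * h'"
  have u_eq: "u = h + P * h^2 / 2 + P^2 * u'" and v_eq: "v = - (1/2) + P^3 * v'"
    and h_eq: "h = - 2 * q + P * y"
    by (simp_all add: u'_def v'_def h'_def y_def field_simps power2_eq_square)
  note q = fermat_quot[folded q_def]
  have int: "p_integral p (- 18 * v' - 3 * u' - 3 * (h' - 2 * q * y + P * y^2 / 2))"
    unfolding y_def using u v q(2) unfolding u'_def[symmetric] v'_def[symmetric] h'_def[symmetric]
    by (intro integral_intros q(1))
  have "- 96 * (P^3 * u / 32 + 3 * P^2 * v / 16) - (9 * P^2 + 6 * P^3 * q - 9 * P^4 * q^2) =
      P^5 * (- 18 * v' - 3 * u' - 3 * (h' - 2 * q * y + P * y^2 / 2))"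
    unfolding u_eq v_eq unfolding h_eq unfolding y_def by (simp add: field_simps power_numeral_reduce)
  then show ?thesis using int unfolding sum by simp
qed

end

section \<open>Assembly, with p = 3 checked by direct evaluation\<close>

theorem theorem1p1:
  fixes p :: nat
  assumes "prime p" and "p > 2"
  shows "rat_cong_pow
    (\<Sum>k = 0..(p - 1) div 2.
        (-1) ^ k * (172 * of_nat k ^ 2 + 75 * of_nat k + 9) / 2 ^ (12 * k)
        * of_nat (2 * k choose k) ^ 3 * of_nat (3 * k choose k) * of_nat (4 * k choose (2 * k)))
    (9 * of_nat p ^ 2 + 6 * of_nat p ^ 3 * fermat_quot2 p - 9 * of_nat p ^ 4 * fermat_quot2 p ^ 2)
    p 5"
proof (cases "p = 3")
  case True
  \<comment> \<open>For p = 3 the two summands are 9 and -9, while the Fermat quotient is 1 and the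
    right side is 81 + 162 - 729 = -2 * 3^5; hence the witness 2 below.\<close>
  have "(\<Sum>k = 0..(p - 1) div 2.
        (-1) ^ k * (172 * of_nat k ^ 2 + 75 * of_nat k + 9) / 2 ^ (12 * k)
        * of_nat (2 * k choose k) ^ 3 * of_nat (3 * k choose k) * of_nat (4 * k choose (2 * k))) = (0 :: rat)"
    by (simp add: True atLeast0AtMost atMost_Suc numeral_eq_Suc binomial_Suc_Suc)
  moreover have "9 * of_nat p ^ 2 + 6 * of_nat p ^ 3 * fermat_quot2 p - 9 * of_nat p ^ 4 * fermat_quot2 p ^ 2
      = (- 2 * of_nat (p ^ 5) :: rat)"
    by (simp add: True fermat_quot2_def)
  ultimately show ?thesis
    unfolding rat_cong_pow_def p_integral_iff[OF assms(1)]
    using assms by (intro exI[of _ 2] exI[of _ 1]) simp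
next
  case False
  obtain m where m: "p = 2 * m + 1"
    using prime_odd_nat[OF assms] by (auto elim: oddE)
  then have "m \<ge> 2" using assms False by simp
  with assms m interpret prime_gt_3 p m by unfold_locales
  have "(p - 1) div 2 = m" using m by simp
  moreover have "(\<Sum>k = 0..m. (-1) ^ k * (172 * of_nat k ^ 2 + 75 * of_nat k + 9) / 2 ^ (12 * k)
        * of_nat (2 * k choose k) ^ 3 * of_nat (3 * k choose k) * of_nat (4 * k choose (2 * k)))
      = - 96 * (\<Sum>n\<le>m. poly (T_poly n) 0)"
    unfolding T_poly_at_0 sum_distrib_left atLeast0AtMost by (rule sum.cong) simp_all
  ultimately show ?thesis
    unfolding rat_cong_pow_def using main_congruence by simp
qed

end
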